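(* Let $0<q\le (1/50)^{1/49}$. Let $f\in L_q^{\infty}[-1,1]$ be a $q$-linear Hölder function of order $\lambda>\frac12$ which satisfies $f(0^+)=f(0^-)$. Then the $q$-Fourier series $S_q[f]$ converges uniformly to $f$ on the set $V_q=\{\pm q^{n-1}: n=1,2,3,\ldots\}$.
   Context: Fix $0<q<1$. Write $(a;q)_n=\prod_{j=0}^{n-1}(1-aq^j)$. The $q$-linear cosine and sine are the entire functions $$C_q(z)=\sum_{n=0}^{\infty}\frac{(-1)^n q^{n(n-1/2)}z^{2n}}{(q;q)_{2n}},\qquad S_q(z)=\sum_{n=0}^{\infty}\frac{(-1)^n q^{n(n+1/2)}z^{2n+1}}{(q;q)_{2n+1}}.$$ All zeros of $S_q$ are real and simple, and they form a countably infinite set symmetric about $0$; its positive zeros are denoted $\omega_1<\omega_2<\omega_3<\cdots$. The $q$-integral is $\int_0^a f(x)\,d_qx=a(1-q)\sum_{n=0}^\infty f(aq^n)q^n$ and $\int_a^b f(x)\,d_qx=\int_0^b f(x)\,d_qx-\int_0^a f(x)\,d_qx$; in particular $\int_{-1}^1 f(x)\,d_qx=(1-q)\sum_{n=0}^\infty\big(f(q^n)+f(-q^n)\big)q^n$. The $q$-Fourier series of $f$ is $$S_q[f](x)=\frac{a_0}{2}+\sum_{k=1}^{\infty}\Big[a_kC_q\big(q^{1/2}\omega_kx\big)+b_kS_q\big(q\omega_kx\big)\Big],$$ with $a_0=\int_{-1}^1f(t)\,d_qt$ and, for $k\ge1$, $$a_k=\frac1{\mu_k}\int_{-1}^1f(t)C_q\big(q^{1/2}\omega_kt\big)d_qt,\qquad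 b_k=\frac{q^{1/2}}{\mu_k}\int_{-1}^1f(t)S_q\big(q\omega_kt\big)d_qt,$$ $$\mu_k=(1-q)\,C_q(q^{1/2}\omega_k)\,S_q'(\omega_k).$$ Functions $f$ are complex-valued and defined on a subset of $\mathbb R$ containing the points $\pm q^{n}$, $n=-1,0,1,2,\ldots$. $L_q^\infty[-1,1]$ is the set of functions $f$ with $\sup\{|f(\pm q^{n-1})|: n=1,2,3,\ldots\}<\infty$ (both signs included). A function $f$ is $q$-linear Hölder of order $\lambda$ if there is a constant $M$ such that, for each choice of sign (the same on both terms), $|f(\pm q^{n-1})-f(\pm q^{n})|\le Mq^{\lambda n}$ for all $n=0,1,2,\ldots$. $f(0^+)$ and $f(0^-)$ denote the one-sided limits of $f(x)$ as $x\to0^+$ and $x\to 0^-$ within the domain of $f$, and the hypothesis $f(0^+)=f(0^-)$ includes that they exist. *)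

theory Defs
  imports "HOL-Analysis.Analysis"
begin

definition qpoch :: "real \<Rightarrow> real \<Rightarrow> nat \<Rightarrow> real" where
  "qpoch a q n = (\<Prod>j<n. 1 - a * q ^ j)"

definition qcos :: "real \<Rightarrow> complex \<Rightarrow> complex" where
  "qcos q z = (\<Sum>n. (-1) ^ n * of_real (q powr (real n * (real n - 1/2)))
                  * z ^ (2 * n) / of_real (qpoch q q (2 * n)))"

definition qsin :: "real \<Rightarrow> complex \<Rightarrow> complex" where
  "qsin q z = (\<Sum>n. (-1) ^ n * of_real (q powr (real n * (real n + 1/2)))
                  * z ^ (2 * n + 1) / of_real (qpoch q q (2 * n + 1)))"

text \<open>
  The \<open>k\<close>-th positive zero of \<^term>\<open>qsin q\<close> in increasing order, for \<open>k \<ge> 1\<close>: the positive zero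
  \<open>x\<close> such that exactly \<open>k\<close> zeros lie in \<open>(0, x]\<close>. Since infinite sets have cardinality 0, the
  set counted is finite whenever \<open>k \<ge> 1\<close>. The value at \<open>k = 0\<close> is never used.
\<close>
definition qsin_zero :: "real \<Rightarrow> nat \<Rightarrow> real" where
  "qsin_zero q k = (THE x. 0 < x \<and> qsin q (of_real x) = 0 \<and>
     card {y::real. 0 < y \<and> y \<le> x \<and> qsin q (of_real y) = 0} = k)"

definition qint0 :: "real \<Rightarrow> real \<Rightarrow> (real \<Rightarrow> complex) \<Rightarrow> complex" where
  "qint0 q a f = of_real (a * (1 - q)) * (\<Sum>n. f (a * q ^ n) * of_real (q ^ n))"

definition qint :: "real \<Rightarrow> real \<Rightarrow> real \<Rightarrow> (real \<Rightarrow> complex) \<Rightarrow> complex" where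
  "qint q a b f = qint0 q b f - qint0 q a f"

definition qmu :: "real \<Rightarrow> nat \<Rightarrow> complex" where
  "qmu q k = of_real (1 - q) * qcos q (of_real (q powr (1/2) * qsin_zero q k))
                * deriv (qsin q) (of_real (qsin_zero q k))"

definition qfourier_a0 :: "real \<Rightarrow> (real \<Rightarrow> complex) \<Rightarrow> complex" where
  "qfourier_a0 q f = qint q (-1) 1 f"

definition qfourier_a :: "real \<Rightarrow> (real \<Rightarrow> complex) \<Rightarrow> nat \<Rightarrow> complex" where
  "qfourier_a q f k = 1 / qmu q k *
     qint q (-1) 1 (\<lambda>t. f t * qcos q (of_real (q powr (1/2) * qsin_zero q k * t)))"

definition qfourier_b :: "real \<Rightarrow> (real \<Rightarrow> complex) \<Rightarrow> nat \<Rightarrow> complex" where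
  "qfourier_b q f k = of_real (q powr (1/2)) / qmu q k *
     qint q (-1) 1 (\<lambda>t. f t * qsin q (of_real (q * qsin_zero q k * t)))"

definition qfourier_partial_sum :: "real \<Rightarrow> (real \<Rightarrow> complex) \<Rightarrow> nat \<Rightarrow> real \<Rightarrow> complex" where
  "qfourier_partial_sum q f N x = qfourier_a0 q f / 2 +
     (\<Sum>k=1..N. qfourier_a q f k * qcos q (of_real (q powr (1/2) * qsin_zero q k * x))
              + qfourier_b q f k * qsin q (of_real (q * qsin_zero q k * x)))"

definition qV :: "real \<Rightarrow> real set" where
  "qV q = {x. \<exists>n::nat. n \<ge> 1 \<and> (x = q ^ (n - 1) \<or> x = - (q ^ (n - 1)))}"

definition qLinf :: "real \<Rightarrow> (real \<Rightarrow> complex) set" where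
  "qLinf q = {f. bdd_above ((\<lambda>x. norm (f x)) ` qV q)}"

text \<open>
  For \<open>n = 0\<close> the condition involves the points \<open>\<plusminus> 1 / q\<close>, so the exponents are integers.
\<close>
definition qlinear_Hoelder :: "real \<Rightarrow> real \<Rightarrow> (real \<Rightarrow> complex) \<Rightarrow> bool" where
  "qlinear_Hoelder q lam f \<longleftrightarrow> (\<exists>M::real. \<forall>n::nat.
     norm (f (q powi (int n - 1)) - f (q powi int n)) \<le> M * q powr (lam * real n) \<and>
     norm (f (- (q powi (int n - 1))) - f (- (q powi int n))) \<le> M * q powr (lam * real n))"

text \<open>
  Here \<open>D\<close> is the domain of \<open>f\<close>; both one-sided limits at 0, taken within \<open>D\<close>, exist and agree.
\<close>
definition one_sided_limits_agree_at_0 :: "real set \<Rightarrow> (real \<Rightarrow> complex) \<Rightarrow> bool" where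
  "one_sided_limits_agree_at_0 D f \<longleftrightarrow> (\<exists>l.
     (f \<longlongrightarrow> l) (at 0 within (D \<inter> {0<..})) \<and> (f \<longlongrightarrow> l) (at 0 within (D \<inter> {..<0})))"

end

theory Submission
  imports Defs "HOL-Complex_Analysis.Complex_Analysis"
begin

text \<open>
  On the grid of points \<open>q\<^sup>n\<close> the functions \<open>C\<^sub>q\<close> and \<open>S\<^sub>q\<close> behave like eigenfunctions of a self-adjoint
  first-order difference system.  Writing \<open>c n = C\<^sub>q(q\<^sup>1\<^sup>/\<^sup>2 w q\<^sup>n)\<close> and \<open>s n = S\<^sub>q(w q\<^sup>n)\<close>, the power series give
  \<open>s n - s (n+1) = w q\<^sup>n c n\<close> and \<open>c n - c (n+1) = - q\<^sup>1\<^sup>/\<^sup>2 w q\<^sup>n s (n+1)\<close>, while \<open>s n\<close> tends to \<open>0\<close>, \<open>c n\<close> tends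
  to \<open>1\<close>, and \<open>S\<^sub>q w = 0\<close> is the boundary condition \<open>s 0 = 0\<close>.  Summation by parts in the weight \<open>q\<^sup>n\<close> then
  yields, exactly as for a Sturm-Liouville problem, that the zeros of \<open>S\<^sub>q\<close> are real and simple, that the
  cosine and the sine systems are orthogonal, and that \<open>\<mu>\<^sub>k\<close> is the normalising constant
  (\<open>pairing_relation\<close>, \<open>qsin_zero_norms\<close>, \<open>qsin_zeros_orthogonal\<close>, \<open>deriv_qsin_at_zero\<close>).

  Completeness of the sine system (\<open>sine_system_complete\<close>) is proved through the resolvent.  If \<open>g\<close> is
  orthogonal to all sine functions, then \<open>F w = \<Sum> q\<^sup>n g\<^sub>n S\<^sub>q(w q\<^sup>n\<^sup>+\<^sup>1)\<close> vanishes at every zero of \<open>S\<^sub>q\<close>, so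
  \<open>F = G S\<^sub>q\<close> with \<open>G\<close> entire.  The number \<open>G w\<close> is the initial value which makes the solution of the
  inhomogeneous difference system with source \<open>g\<close> decay; the self-adjoint energy identity bounds
  \<open>\<bar>Im (w\<^sup>2)\<bar> \<bar>G w\<bar>\<close> by a constant, and an entire function with such a bound is zero.  The same bound, used
  once more with \<open>G = 0\<close>, gives \<open>g = 0\<close>.

  For the convergence, split the restriction of \<open>f\<close> to the grid into its even and odd parts.  A Hoelder
  exponent larger than \<open>1/2\<close> is what makes the \<open>q\<close>-difference quotient of \<open>f\<close> square summable in
  the weight \<open>q\<^sup>n\<close>.  The difference quotient of the odd part is expanded in the cosine system together
  with the constant function, that of the even part in the sine system; both expansions converge in the
  weighted \<open>\<ell>\<^sup>2\<close> norm (\<open>orthogonal_expansion_converges\<close>).  The coefficients are those of \<open>f\<close> up to the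
  frequency, so summing the difference quotients back up recovers the partial sums of the Fourier series,
  and by Cauchy-Schwarz the \<open>\<ell>\<^sup>2\<close> error of the quotients controls the error of the sums uniformly on the grid
  (\<open>telescoped_bound\<close>).  The condition \<open>f(0\<^sup>+) = f(0\<^sup>-)\<close> says that the odd part tends to \<open>0\<close>, as every sine
  function does.
\<close>

section \<open>The q-linear exponential function\<close>

text \<open>
  One power series carries both trigonometric functions: \<open>C\<^sub>q(z) + \<i> S\<^sub>q(z)\<close> is its value at \<open>\<i> z\<close>.  In terms of
  \<open>q\<^sup>1\<^sup>/\<^sup>2\<close> the exponents \<open>n (n - 1/2)\<close> and \<open>n (n + 1/2)\<close> both become \<open>m choose 2\<close>, for \<open>m = 2 n\<close> and \<open>m = 2 n + 1\<close>.
\<close>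
definition qlexp :: "real \<Rightarrow> complex \<Rightarrow> complex" where
  "qlexp q z = (\<Sum>m. of_real (sqrt q ^ (m choose 2) / qpoch q q m) * z ^ m)"

lemma Suc_choose_2: "Suc m choose 2 = m + (m choose 2)"
  by (simp add: numeral_2_eq_2)

lemma real_choose_2: "real (m choose 2) = real m * (real m - 1) / 2"
  by (induction m) (simp_all add: Suc_choose_2 field_simps del: binomial_Suc_n)

locale qtrig =
  fixes q :: real
  assumes q_pos: "0 < q" and q_less_1: "q < 1"
begin

abbreviation r :: real where "r \<equiv> sqrt q"

lemma r_pos: "0 < r" and r_less_1: "r < 1" and r_sq: "r * r = q"
  using q_pos q_less_1 by (auto simp: real_sqrt_lt_1_iff)

lemma qpoch_Suc: "qpoch q q (Suc m) = qpoch q q m * (1 - q ^ Suc m)"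
  by (simp add: qpoch_def)

lemma qpoch_pos: "0 < qpoch q q m"
proof (induction m)
  case (Suc m)
  have "q ^ Suc m < 1" using q_pos q_less_1 by (intro power_Suc_less_one) auto
  with Suc show ?case unfolding qpoch_Suc by simp
qed (simp add: qpoch_def)

lemma r_power_choose_2: "r ^ (m choose 2) = q powr (real m * (real m - 1) / 4)"
proof -
  have "r ^ (m choose 2) = (q powr (1/2)) ^ (m choose 2)"
    using q_pos by (simp add: powr_half_sqrt)
  also have "\<dots> = q powr (real m * (real m - 1) / 4)"
    using q_pos by (simp add: powr_power real_choose_2 mult.commute)
  finally show ?thesis .
qed

text \<open>
  The ratio of consecutive terms is at most \<open>r\<^sup>m \<bar>z\<bar> / (1 - q)\<close>, which tends to \<open>0\<close>.
\<close>
lemma summable_qlexp: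
  fixes z :: complex
  shows "summable (\<lambda>m. of_real (r ^ (m choose 2) / qpoch q q m) * z ^ m)"
proof -
  have "(\<lambda>m. r ^ m * (norm z / (1 - q))) \<longlonglongrightarrow> 0 * (norm z / (1 - q))"
    using r_pos r_less_1 by (intro tendsto_intros LIMSEQ_realpow_zero) auto
  then have "eventually (\<lambda>m. r ^ m * (norm z / (1 - q)) < 1/2) sequentially"
    by (rule order_tendstoD) simp
  then obtain N where N: "\<And>m. m \<ge> N \<Longrightarrow> r ^ m * (norm z / (1 - q)) < 1/2"
    by (auto simp: eventually_sequentially)
  show ?thesis
  proof (rule summable_ratio_test[where c = "1/2" and N = N])
    fix m assume "N \<le> m"
    have qm: "1 - q \<le> 1 - q ^ Suc m"
      using q_pos q_less_1 power_Suc_le_self[of q m] by simp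
    then have qm_pos: "0 < 1 - q ^ Suc m" using q_less_1 by linarith
    define A where "A = r ^ (m choose 2) / qpoch q q m * norm z ^ m"
    have A: "A \<ge> 0" using qpoch_pos[of m] r_pos by (simp add: A_def)
    have "norm (of_real (r ^ (Suc m choose 2) / qpoch q q (Suc m)) * z ^ Suc m)
            = r ^ (Suc m choose 2) / qpoch q q (Suc m) * norm z ^ Suc m"
      unfolding norm_mult norm_power norm_of_real using qpoch_pos[of "Suc m"] r_pos by simp
    also have "\<dots> = (r ^ m * (norm z / (1 - q ^ Suc m))) * A"
      unfolding A_def Suc_choose_2 by (simp add: power_add qpoch_Suc mult_ac)
    also have "\<dots> \<le> (r ^ m * (norm z / (1 - q))) * A"
      using qm qm_pos q_less_1 r_pos A
      by (intro mult_right_mono mult_left_mono divide_left_mono mult_pos_pos qm_pos) auto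
    also have "\<dots> \<le> 1/2 * A"
      using N[OF \<open>N \<le> m\<close>] A by (intro mult_right_mono) auto
    also have "A = norm (of_real (r ^ (m choose 2) / qpoch q q m) * z ^ m)"
      using qpoch_pos[of m] r_pos by (simp add: A_def norm_mult norm_divide norm_power)
    finally show "norm (of_real (r ^ (Suc m choose 2) / qpoch q q (Suc m)) * z ^ Suc m)
        \<le> 1/2 * norm (of_real (r ^ (m choose 2) / qpoch q q m) * z ^ m :: complex)" .
  qed simp
qed

lemma qlexp_sums: "(\<lambda>m. of_real (r ^ (m choose 2) / qpoch q q m) * z ^ m) sums qlexp q z"
  unfolding qlexp_def by (rule summable_sums[OF summable_qlexp])

lemma qlexp_holomorphic: "qlexp q holomorphic_on UNIV"
  using termdiffs_strong_converges_everywhere[OF summable_qlexp]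
  unfolding holomorphic_on_def field_differentiable_def qlexp_def[abs_def] by blast

lemma qlexp_0: "qlexp q 0 = 1"
proof -
  have "qlexp q 0 = of_real (r ^ (0 choose 2) / qpoch q q 0)"
    unfolding qlexp_def by (rule powser_zero)
  then show ?thesis by (simp add: qpoch_def numeral_2_eq_2)
qed

text \<open>
  The factor \<open>1 - q\<^sup>m\<close> produced by the difference cancels the last factor of \<open>(q;q)\<^sub>m\<close>, and
  \<open>m + 1 choose 2 = m + (m choose 2)\<close> turns the shift of the index into the dilation by \<open>r\<close>.
\<close>
lemma qlexp_diff: "qlexp q z - qlexp q (of_real q * z) = z * qlexp q (of_real r * z)"
proof -
  let ?e = "\<lambda>m. r ^ (m choose 2) / qpoch q q m"
  have rec: "?e (Suc m) * (1 - q ^ Suc m) = ?e m * r ^ m" for m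
  proof -
    have "1 - q ^ Suc m > 0"
      using power_Suc_less_one[of q m] q_pos q_less_1 by simp
    then show ?thesis
      using qpoch_pos[of m] by (simp add: Suc_choose_2 qpoch_Suc power_add)
  qed
  have "(\<lambda>m. of_real (?e m) * z ^ m - of_real (?e m) * (of_real q * z) ^ m)
          sums (qlexp q z - qlexp q (of_real q * z))"
    by (intro sums_diff qlexp_sums)
  then have 1: "(\<lambda>m. of_real (?e (Suc m)) * z ^ Suc m - of_real (?e (Suc m)) * (of_real q * z) ^ Suc m)
          sums (qlexp q z - qlexp q (of_real q * z))"
    by (subst sums_Suc_iff) simp
  have "(\<lambda>m. z * (of_real (?e m) * (of_real r * z) ^ m)) sums (z * qlexp q (of_real r * z))"
    by (intro sums_mult qlexp_sums)
  moreover have "of_real (?e (Suc m)) * z ^ Suc m - of_real (?e (Suc m)) * (of_real q * z) ^ Suc m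
       = z * (of_real (?e m) * (of_real r * z) ^ m)" for m
  proof -
    have "of_real (?e (Suc m)) * z ^ Suc m - of_real (?e (Suc m)) * (of_real q * z) ^ Suc m
        = of_real (?e (Suc m) * (1 - q ^ Suc m)) * z ^ Suc m"
      unfolding of_real_mult of_real_diff of_real_1 of_real_power power_mult_distrib
      by (simp add: algebra_simps del: of_real_divide of_real_power)
    also have "\<dots> = z * (of_real (?e m) * (of_real r * z) ^ m)"
      unfolding rec by (simp add: power_mult_distrib)
    finally show ?thesis .
  qed
  ultimately show ?thesis using 1 sums_unique2 by auto
qed

lemma qcos_eq: "qcos q z = (qlexp q (\<i> * z) + qlexp q (- (\<i> * z))) / 2"
proof -
  let ?t = "\<lambda>m. (of_real (r ^ (m choose 2) / qpoch q q m) * (\<i> * z) ^ m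
                + of_real (r ^ (m choose 2) / qpoch q q m) * (- (\<i> * z)) ^ m) / 2"
  have "?t sums ((qlexp q (\<i> * z) + qlexp q (- (\<i> * z))) / 2)"
    by (intro sums_divide sums_add qlexp_sums)
  moreover have "?t m = 0" if "m \<notin> range (\<lambda>n. 2 * n)" for m
  proof -
    have "odd m" using that by (auto elim!: evenE)
    then show ?thesis by (simp add: power_minus_odd)
  qed
  ultimately have "(\<lambda>n. ?t (2 * n)) sums ((qlexp q (\<i> * z) + qlexp q (- (\<i> * z))) / 2)"
    by (subst sums_mono_reindex) (auto simp: strict_mono_def)
  moreover have "?t (2 * n) = (-1) ^ n * of_real (q powr (real n * (real n - 1/2)))
                  * z ^ (2 * n) / of_real (qpoch q q (2 * n))" for n
  proof -
    have "real (2 * n) * (real (2 * n) - 1) / 4 = real n * (real n - 1/2)"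
      by (simp add: field_simps)
    then have "r ^ (2 * n choose 2) = q powr (real n * (real n - 1/2))"
      by (simp only: r_power_choose_2)
    moreover have "(\<i> * z) ^ (2 * n) = (-1) ^ n * z ^ (2 * n)"
      by (simp add: power_mult power_mult_distrib power_minus[of "z\<^sup>2"])
    moreover have "(- (\<i> * z)) ^ (2 * n) = (\<i> * z) ^ (2 * n)"
      by simp
    ultimately show ?thesis by simp
  qed
  ultimately have "(\<lambda>n. (-1) ^ n * of_real (q powr (real n * (real n - 1/2)))
                  * z ^ (2 * n) / of_real (qpoch q q (2 * n)))
       sums ((qlexp q (\<i> * z) + qlexp q (- (\<i> * z))) / 2)"
    by (simp only:)
  then show ?thesis unfolding qcos_def by (rule sums_unique[symmetric])
qed

lemma qsin_eq: "qsin q z = (qlexp q (\<i> * z) - qlexp q (- (\<i> * z))) / (2 * \<i>)"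
proof -
  let ?t = "\<lambda>m. (of_real (r ^ (m choose 2) / qpoch q q m) * (\<i> * z) ^ m
                - of_real (r ^ (m choose 2) / qpoch q q m) * (- (\<i> * z)) ^ m) / (2 * \<i>)"
  have "?t sums ((qlexp q (\<i> * z) - qlexp q (- (\<i> * z))) / (2 * \<i>))"
    by (intro sums_divide sums_diff qlexp_sums)
  moreover have "?t m = 0" if "m \<notin> range (\<lambda>n. 2 * n + 1)" for m
  proof -
    have "even m" using that oddE by blast
    then show ?thesis by simp
  qed
  ultimately have "(\<lambda>n. ?t (2 * n + 1)) sums ((qlexp q (\<i> * z) - qlexp q (- (\<i> * z))) / (2 * \<i>))"
    by (subst sums_mono_reindex[where g = "\<lambda>n. 2 * n + 1"]) (auto simp: strict_mono_def)
  moreover have "?t (2 * n + 1) = (-1) ^ n * of_real (q powr (real n * (real n + 1/2)))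
                  * z ^ (2 * n + 1) / of_real (qpoch q q (2 * n + 1))" for n
  proof -
    have "real (2 * n + 1) * (real (2 * n + 1) - 1) / 4 = real n * (real n + 1/2)"
      by (simp add: field_simps)
    then have *: "r ^ (2 * n + 1 choose 2) = q powr (real n * (real n + 1/2))"
      by (simp only: r_power_choose_2)
    define c where "c = complex_of_real (q powr (real n * (real n + 1/2)))"
    define d where "d = complex_of_real (qpoch q q (2 * n + 1))"
    have "(\<i> * z) ^ (2 * n + 1) = \<i> * (-1) ^ n * z ^ (2 * n + 1)"
      by (simp add: power_mult power_mult_distrib power_minus[of "z\<^sup>2"])
    moreover have "(- (\<i> * z)) ^ (2 * n + 1) = - ((\<i> * z) ^ (2 * n + 1))"
      by (rule power_minus_odd) simp
    ultimately show ?thesis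
      unfolding * of_real_divide c_def[symmetric] d_def[symmetric] by simp
  qed
  ultimately have "(\<lambda>n. (-1) ^ n * of_real (q powr (real n * (real n + 1/2)))
                  * z ^ (2 * n + 1) / of_real (qpoch q q (2 * n + 1)))
       sums ((qlexp q (\<i> * z) - qlexp q (- (\<i> * z))) / (2 * \<i>))"
    by (simp only:)
  then show ?thesis unfolding qsin_def by (rule sums_unique[symmetric])
qed

lemma qcos_holomorphic: "qcos q holomorphic_on A"
proof -
  have "(\<lambda>z. (qlexp q (\<i> * z) + qlexp q (- (\<i> * z))) / 2) holomorphic_on A"
    by (intro holomorphic_intros holomorphic_on_compose_gen[OF _ qlexp_holomorphic, unfolded o_def]) auto
  then show ?thesis by (simp add: qcos_eq[abs_def])
qed

lemma qsin_holomorphic: "qsin q holomorphic_on A"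
proof -
  have "(\<lambda>z. (qlexp q (\<i> * z) - qlexp q (- (\<i> * z))) / (2 * \<i>)) holomorphic_on A"
    by (intro holomorphic_intros holomorphic_on_compose_gen[OF _ qlexp_holomorphic, unfolded o_def]) auto
  then show ?thesis by (simp add: qsin_eq[abs_def])
qed

lemma qcos_even: "qcos q (- z) = qcos q z" and qsin_odd: "qsin q (- z) = - qsin q z"
  and qcos_0: "qcos q 0 = 1" and qsin_0: "qsin q 0 = 0"
  by (simp_all add: qcos_eq qsin_eq qlexp_0 field_simps)

text \<open>
  The even and odd parts of \<open>qlexp_diff\<close>: the \<open>q\<close>-analogues of \<open>cos' = - sin\<close> and \<open>sin' = cos\<close>.
\<close>
lemma qcos_diff: "qcos q z - qcos q (of_real q * z) = - z * qsin q (of_real r * z)"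
  and qsin_diff: "qsin q z - qsin q (of_real q * z) = z * qcos q (of_real r * z)"
proof -
  note d = qlexp_diff[of "\<i> * z"] qlexp_diff[of "- (\<i> * z)"]
  let ?p = "qlexp q (\<i> * z)" and ?m = "qlexp q (- (\<i> * z))"
  let ?p' = "qlexp q (\<i> * (of_real q * z))" and ?m' = "qlexp q (- (\<i> * (of_real q * z)))"
  let ?p'' = "qlexp q (\<i> * (of_real r * z))" and ?m'' = "qlexp q (- (\<i> * (of_real r * z)))"
  have p: "?p' = ?p - \<i> * z * ?p''" and m: "?m' = ?m + \<i> * z * ?m''"
    using d by (simp_all add: algebra_simps mult.left_commute)
  show "qcos q z - qcos q (of_real q * z) = - z * qsin q (of_real r * z)"
    unfolding qcos_eq qsin_eq p m by (simp add: field_simps)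
  show "qsin q z - qsin q (of_real q * z) = z * qcos q (of_real r * z)"
    unfolding qcos_eq qsin_eq p m by (simp add: field_simps)
qed

lemma cnj_qlexp: "cnj (qlexp q z) = qlexp q (cnj z)"
proof -
  have "(\<lambda>m. cnj (of_real (r ^ (m choose 2) / qpoch q q m) * z ^ m)) sums cnj (qlexp q z)"
    by (simp only: sums_cnj qlexp_sums)
  then show ?thesis using sums_unique2[OF _ qlexp_sums[of "cnj z"]] by simp
qed

lemma cnj_qcos: "cnj (qcos q z) = qcos q (cnj z)" and cnj_qsin: "cnj (qsin q z) = qsin q (cnj z)"
  by (simp_all add: qcos_eq qsin_eq cnj_qlexp field_simps)

lemma qcos_of_real: "of_real (Re (qcos q (of_real x))) = qcos q (of_real x)"
  and qsin_of_real: "of_real (Re (qsin q (of_real x))) = qsin q (of_real x)"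
  using cnj_qcos[of "of_real x"] cnj_qsin[of "of_real x"]
  by (auto simp: complex_eq_iff)

text \<open>
  Differentiating \<open>qsin_diff\<close> at \<open>0\<close> gives \<open>(1 - q) S\<^sub>q'(0) = 1\<close>.
\<close>
lemma deriv_qsin_0: "deriv (qsin q) 0 \<noteq> 0"
proof -
  have S: "(qsin q has_field_derivative deriv (qsin q) z) (at z)" for z
    using qsin_holomorphic[of UNIV] by (simp add: holomorphic_derivI)
  have C: "(qcos q has_field_derivative deriv (qcos q) z) (at z)" for z
    using qcos_holomorphic[of UNIV] by (simp add: holomorphic_derivI)
  have "((\<lambda>z. qsin q z - qsin q (of_real q * z)) has_field_derivative
          (deriv (qsin q) 0 - deriv (qsin q) (of_real q * 0) * of_real q)) (at 0)"
    by (rule derivative_eq_intros S DERIV_chain2[where f = "qsin q"] refl | simp)+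
  moreover have "((\<lambda>z. z * qcos q (of_real r * z)) has_field_derivative 1) (at 0)"
    by (rule derivative_eq_intros C DERIV_chain2[where f = "qcos q"] refl | simp add: qcos_0)+
  ultimately have "deriv (qsin q) 0 - deriv (qsin q) (of_real q * 0) * of_real q = 1"
    unfolding qsin_diff using DERIV_unique by blast
  then show ?thesis by auto
qed

end

section \<open>Entire functions\<close>

text \<open>
  On each ball the arguments \<open>t n * w\<close> stay in that ball, where \<open>h\<close> is bounded, so the series converges
  uniformly by the Weierstrass test.
\<close>
lemma entire_series_dilations:
  fixes h :: "complex \<Rightarrow> complex" and g :: "nat \<Rightarrow> complex" and t :: "nat \<Rightarrow> real"
  assumes h: "h holomorphic_on UNIV" and g: "summable (\<lambda>n. norm (g n))"
    and t: "\<And>n. \<bar>t n\<bar> \<le> 1"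
  shows "(\<lambda>w. \<Sum>n. g n * h (of_real (t n) * w)) holomorphic_on UNIV"
proof -
  have "(\<lambda>w. \<Sum>n. g n * h (of_real (t n) * w)) holomorphic_on ball 0 R" if R: "R > 0" for R
  proof -
    have hcont: "continuous_on A h" for A
      using h holomorphic_on_imp_continuous_on holomorphic_on_subset by blast
    have "bounded (h ` cball 0 R)"
      by (intro compact_imp_bounded compact_continuous_image hcont compact_cball)
    then obtain K where "\<forall>z\<in>cball 0 R. norm (h z) \<le> K"
      by (auto simp: bounded_iff)
    then have K: "\<And>z. norm z \<le> R \<Longrightarrow> norm (h z) \<le> K" by auto
    have "norm (of_real (t n) * w) \<le> R" if "norm w \<le> R" for w :: complex and n
      using mult_mono[OF t that] by (simp add: norm_mult)
    then have bnd: "norm (g n * h (of_real (t n) * w)) \<le> norm (g n) * K" if "norm w \<le> R" for n w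
      using K that by (simp add: norm_mult mult_left_mono)
    have hol: "(\<lambda>w. \<Sum>i<n. g i * h (of_real (t i) * w)) holomorphic_on A" for n A
      by (intro holomorphic_intros holomorphic_on_compose_gen[OF _ h, unfolded o_def]) auto
    have "uniform_limit (cball 0 R) (\<lambda>n w. \<Sum>i<n. g i * h (of_real (t i) * w))
            (\<lambda>w. \<Sum>n. g n * h (of_real (t n) * w)) sequentially"
      by (rule Weierstrass_m_test[OF _ summable_mult2[OF g]]) (use bnd in auto)
    then show ?thesis
      by (rule holomorphic_uniform_limit[rotated])
         (auto intro!: always_eventually hol holomorphic_on_imp_continuous_on)
  qed
  then have "(\<lambda>w. \<Sum>n. g n * h (of_real (t n) * w)) holomorphic_on (\<Union>R\<in>{0<..}. ball 0 R)"
    by (intro holomorphic_on_UN_open) auto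
  moreover have "z \<in> (\<Union>R\<in>{0<..}. ball 0 R)" for z :: complex
    by (rule UN_I[of "norm z + 1"]) (auto intro: add_nonneg_pos)
  then have "(\<Union>R\<in>{0<..}. ball 0 R) = (UNIV :: complex set)" by blast
  ultimately show ?thesis by simp
qed

lemma entire_quotient:
  fixes F S :: "complex \<Rightarrow> complex"
  assumes F: "F holomorphic_on UNIV" and S: "S holomorphic_on UNIV"
    and simple: "\<And>a. S a = 0 \<Longrightarrow> deriv S a \<noteq> 0"
    and vanish: "\<And>a. S a = 0 \<Longrightarrow> F a = 0"
  obtains G where "G holomorphic_on UNIV" "\<And>w. F w = G w * S w"
proof -
  define G where "G w = (if S w = 0 then deriv F w / deriv S w else F w / S w)" for w
  have transfer: "G field_differentiable (at a)"
    if "eventually (\<lambda>z. G z = H z) (nhds a)" "H field_differentiable (at a)" for a H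
    using that DERIV_cong_ev[OF refl that(1) refl] unfolding field_differentiable_def by blast
  have "G field_differentiable (at a)" for a
  proof -
    \<comment> \<open>Divided differences at \<open>a\<close> remove the common factor \<open>z - a\<close>.\<close>
    define dq where "dq f z = (if z = a then deriv f a else (f z - f a) / (z - a))"
      for f :: "complex \<Rightarrow> complex" and z
    have dq_hol: "dq f holomorphic_on UNIV" if "f holomorphic_on UNIV" for f
      unfolding dq_def[abs_def] by (rule pole_lemma[OF that]) simp
    show ?thesis
    proof (cases "S a = 0")
      case True
      have Fa: "F a = 0" using vanish True by simp
      have ne: "dq S a \<noteq> 0" using simple[OF True] by (simp add: dq_def)
      have "isCont (dq S) a"
        using holomorphic_on_imp_continuous_on[OF dq_hol[OF S]]
        by (simp add: continuous_on_eq_continuous_at)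
      then have "eventually (\<lambda>z. dq S z \<noteq> 0) (nhds a)"
        using ne by (simp add: isCont_def tendsto_imp_eventually_ne tendsto_at_iff_tendsto_nhds)
      then have "eventually (\<lambda>z. G z = dq F z / dq S z) (nhds a)"
      proof eventually_elim
        case (elim z)
        show ?case
          using True Fa elim by (auto simp: G_def dq_def)
      qed
      moreover have "(\<lambda>z. dq F z / dq S z) field_differentiable (at a)"
        using dq_hol[OF F] dq_hol[OF S] ne
        by (intro field_differentiable_divide) (auto simp: holomorphic_on_def)
      ultimately show ?thesis
        by (rule transfer)
    next
      case False
      have "isCont S a"
        using holomorphic_on_imp_continuous_on[OF S] by (simp add: continuous_on_eq_continuous_at)
      then have "eventually (\<lambda>z. S z \<noteq> 0) (nhds a)"
        using False by (simp add: isCont_def tendsto_imp_eventually_ne tendsto_at_iff_tendsto_nhds)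
      then have "eventually (\<lambda>z. G z = F z / S z) (nhds a)"
        by eventually_elim (simp add: G_def)
      moreover have "(\<lambda>z. F z / S z) field_differentiable (at a)"
        using F S False by (intro field_differentiable_divide) (auto simp: holomorphic_on_def)
      ultimately show ?thesis
        by (rule transfer)
    qed
  qed
  then have "G holomorphic_on UNIV" by (simp add: holomorphic_on_def)
  moreover have "F w = G w * S w" for w using vanish by (auto simp: G_def)
  ultimately show ?thesis using that by blast
qed

text \<open>
  The bound says nothing on the lines \<open>Im (w\<^sup>2) = 0\<close>.  Multiplication by \<open>z\<^sup>4 - R\<^sup>4\<close>, which vanishes where these
  lines meet the circle of radius \<open>R\<close>, turns it into a bound \<open>2 R\<^sup>2 C\<close> on the whole circle; the maximum principle
  carries this to the points with \<open>2 \<bar>w\<bar> \<le> R\<close>, where the multiplier has size at least \<open>R\<^sup>4 / 2\<close>, and \<open>R\<close> tends to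
  infinity.
\<close>
lemma entire_eq_0_if_resolvent_bound:
  fixes G :: "complex \<Rightarrow> complex"
  assumes G: "G holomorphic_on UNIV"
    and bound: "\<And>w. Im (w\<^sup>2) \<noteq> 0 \<Longrightarrow> \<bar>Im (w\<^sup>2)\<bar> * norm (G w) \<le> C"
  shows "G w = 0"
proof -
  have C: "C \<ge> 0"
  proof -
    have "0 \<le> \<bar>Im ((1 + \<i>)\<^sup>2)\<bar> * norm (G (1 + \<i>))" by simp
    also have "\<dots> \<le> C" by (rule bound) (simp add: power2_eq_square)
    finally show ?thesis .
  qed
  have key: "norm (G w) \<le> 4 * C / R\<^sup>2" if R: "R > 0" "R \<ge> 2 * norm w" for R
  proof -
    define H where "H z = G z * (z ^ 4 - of_real (R ^ 4))" for z
    have H: "H holomorphic_on A" for A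
      unfolding H_def[abs_def] by (intro holomorphic_intros holomorphic_on_subset[OF G]) simp
    have "norm (H w) \<le> 2 * R\<^sup>2 * C"
    proof (rule maximum_modulus_frontier[where f = H and \<xi> = w and S = "cball 0 R"])
      fix z :: complex assume "z \<in> frontier (cball 0 R)"
      then have z: "norm z = R" using R by simp
      \<comment> \<open>With \<open>u = z\<^sup>2\<close> one has \<open>R\<^sup>4 = u * cnj u\<close>, so that \<open>u\<^sup>2 - R\<^sup>4 = 2 \<i> u Im u\<close>.\<close>
      have "complex_of_real (R ^ 4) = z\<^sup>2 * cnj (z\<^sup>2)"
        unfolding complex_norm_square[symmetric] using z by (simp add: norm_power flip: power_mult)
      then have "z ^ 4 - of_real (R ^ 4) = z\<^sup>2 * (z\<^sup>2 - cnj (z\<^sup>2))"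
        by (simp add: algebra_simps flip: power_add)
      also have "norm \<dots> = R\<^sup>2 * (2 * \<bar>Im (z\<^sup>2)\<bar>)"
        unfolding complex_diff_cnj using z by (simp add: norm_mult norm_power)
      finally have "norm (H z) = 2 * R\<^sup>2 * (\<bar>Im (z\<^sup>2)\<bar> * norm (G z))"
        by (simp add: H_def norm_mult)
      also have "\<dots> \<le> 2 * R\<^sup>2 * C"
        using bound[of z] C by (cases "Im (z\<^sup>2) = 0") (auto intro!: mult_left_mono)
      finally show "norm (H z) \<le> 2 * R\<^sup>2 * C" .
    qed (use R in \<open>auto intro!: H holomorphic_on_imp_continuous_on\<close>)
    moreover have "R ^ 4 / 2 \<le> norm (w ^ 4 - of_real (R ^ 4))"
    proof -
      have "norm (w ^ 4) \<le> (R / 2) ^ 4"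
        unfolding norm_power using R by (intro power_mono) auto
      also have "\<dots> \<le> R ^ 4 / 2" by (simp add: power_divide)
      also have "\<dots> = norm (of_real (R ^ 4) :: complex) - R ^ 4 / 2"
        unfolding norm_of_real by simp
      finally have "R ^ 4 / 2 \<le> norm (of_real (R ^ 4) :: complex) - norm (w ^ 4)"
        by linarith
      also have "\<dots> \<le> norm (w ^ 4 - of_real (R ^ 4))"
        by (metis norm_minus_commute norm_triangle_ineq2)
      finally show ?thesis .
    qed
    then have "norm (G w) * (R ^ 4 / 2) \<le> norm (H w)"
      unfolding H_def norm_mult by (rule mult_left_mono) simp
    ultimately have "norm (G w) * (R ^ 4 / 2) \<le> 2 * R\<^sup>2 * C" by linarith
    then have "(norm (G w) * R\<^sup>2) * R\<^sup>2 \<le> (4 * C) * R\<^sup>2"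
      by (simp add: power4_eq_xxxx power2_eq_square mult_ac)
    then have "norm (G w) * R\<^sup>2 \<le> 4 * C"
      by (rule mult_right_le_imp_le) (use R in simp)
    then show ?thesis using R by (simp add: field_simps)
  qed
  have "((\<lambda>R. 4 * C / R\<^sup>2) \<longlongrightarrow> 0) at_top"
    by real_asymp
  moreover have "eventually (\<lambda>R. norm (G w) \<le> 4 * C / R\<^sup>2) at_top"
    using eventually_ge_at_top[of "2 * norm w"] eventually_gt_at_top[of 0]
    by eventually_elim (rule key)
  ultimately have "norm (G w) \<le> 0"
    by (intro tendsto_lowerbound[of _ _ at_top]) auto
  then show ?thesis by simp
qed

section \<open>Summation tools\<close>

lemma sums_by_parts:
  fixes A B :: "nat \<Rightarrow> complex"
  assumes lim: "(\<lambda>n. A n * B n) \<longlonglongrightarrow> 0"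
    and sums: "(\<lambda>n. A (Suc n) * (B (Suc n) - B n)) sums t"
  shows "(\<lambda>n. (A n - A (Suc n)) * B n) sums (A 0 * B 0 + t)"
proof -
  have "(\<lambda>n. A n * B n - A (Suc n) * B (Suc n)) sums (A 0 * B 0 - 0)"
    by (rule telescope_sums'[OF lim])
  then have "(\<lambda>n. (A n * B n - A (Suc n) * B (Suc n)) + A (Suc n) * (B (Suc n) - B n))
               sums (A 0 * B 0 - 0 + t)"
    using sums by (rule sums_add)
  then show ?thesis by (simp add: algebra_simps)
qed

text \<open>
  A discrete Gronwall inequality.
\<close>
lemma bounded_if_summable_growth:
  fixes m k :: "nat \<Rightarrow> real"
  assumes k: "summable k" "\<And>n. k n \<ge> 0" and m: "m 0 \<ge> 0" "\<And>n. m (Suc n) \<le> (1 + k n) * m n"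
  shows "m n \<le> m 0 * exp (suminf k)"
proof -
  have "m n \<le> m 0 * exp (\<Sum>i<n. k i)"
  proof (induction n)
    case (Suc n)
    have "m (Suc n) \<le> (1 + k n) * m n" by (rule m)
    also have "\<dots> \<le> (1 + k n) * (m 0 * exp (\<Sum>i<n. k i))"
      using Suc k(2)[of n] by (intro mult_left_mono) auto
    also have "\<dots> \<le> exp (k n) * (m 0 * exp (\<Sum>i<n. k i))"
      using m(1) exp_ge_add_one_self[of "k n"] by (intro mult_right_mono) auto
    also have "\<dots> = m 0 * exp (\<Sum>i<Suc n. k i)" by (simp add: exp_add)
    finally show ?case .
  qed simp
  also have "\<dots> \<le> m 0 * exp (suminf k)"
    using m(1) k by (intro mult_left_mono) (auto intro: sum_le_suminf)
  finally show ?thesis .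
qed

section \<open>Orthogonal expansions in a weighted sequence space\<close>

lemma weighted_Cauchy_Schwarz:
  fixes p \<phi> :: "nat \<Rightarrow> real" and y :: "nat \<Rightarrow> complex"
  assumes p: "\<And>n. 0 \<le> p n"
    and A: "(\<lambda>n. p n * (\<phi> n)\<^sup>2) sums A" and B: "(\<lambda>n. p n * (norm (y n))\<^sup>2) sums B"
  shows "summable (\<lambda>n. norm (of_real (p n * \<phi> n) * y n))"
    and "(\<Sum>n. norm (of_real (p n * \<phi> n) * y n))\<^sup>2 \<le> A * B"
proof -
  let ?t = "\<lambda>n. norm (of_real (p n * \<phi> n) * y n)"
  have A0: "A \<ge> 0" and B0: "B \<ge> 0"
    using sums_le[OF _ sums_zero A] sums_le[OF _ sums_zero B] p by auto
  have fin: "(\<Sum>n<K. ?t n) \<le> sqrt (A * B)" for K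
  proof -
    have t: "?t n = (sqrt (p n) * \<bar>\<phi> n\<bar>) * (sqrt (p n) * norm (y n))" for n
      using p[of n] by (simp add: norm_mult abs_mult mult_ac flip: real_sqrt_mult)
    have "(\<Sum>n<K. ?t n)\<^sup>2 \<le> (\<Sum>n<K. (sqrt (p n) * \<bar>\<phi> n\<bar>)\<^sup>2) * (\<Sum>n<K. (sqrt (p n) * norm (y n))\<^sup>2)"
      unfolding t by (rule Cauchy_Schwarz_ineq_sum)
    also have "\<dots> = (\<Sum>n<K. p n * (\<phi> n)\<^sup>2) * (\<Sum>n<K. p n * (norm (y n))\<^sup>2)"
      using p by (simp add: power_mult_distrib)
    also have "\<dots> \<le> A * B"
      unfolding sums_unique[OF A] sums_unique[OF B]
      using p A B
      by (intro mult_mono sum_le_suminf sum_nonneg suminf_nonneg) (auto simp: sums_iff)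
    finally show ?thesis by (rule real_le_rsqrt)
  qed
  show summ: "summable ?t"
    by (rule summableI_nonneg_bounded[OF _ fin]) simp
  have "suminf ?t \<le> sqrt (A * B)"
    using summ fin by (intro suminf_le_const) auto
  then have "(suminf ?t)\<^sup>2 \<le> (sqrt (A * B))\<^sup>2"
    by (intro power_mono suminf_nonneg summ) auto
  then show "(suminf ?t)\<^sup>2 \<le> A * B" using A0 B0 by simp
qed

text \<open>
  The single step of Bessel's identity.
\<close>
lemma weighted_norm_subtract_multiple:
  fixes p \<phi> :: "nat \<Rightarrow> real" and y :: "nat \<Rightarrow> complex"
  assumes Y: "(\<lambda>n. p n * (norm (y n))\<^sup>2) sums Y"
    and c: "(\<lambda>n. of_real (p n * \<phi> n) * y n) sums c"
    and \<nu>: "(\<lambda>n. p n * (\<phi> n)\<^sup>2) sums \<nu>"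
  shows "(\<lambda>n. p n * (norm (y n - a * of_real (\<phi> n)))\<^sup>2) sums
           (Y - 2 * Re (c * cnj a) + \<nu> * (norm a)\<^sup>2)"
proof -
  have "(\<lambda>n. of_real (p n * \<phi> n) * y n * cnj a) sums (c * cnj a)"
    by (rule sums_mult2[OF c])
  then have "(\<lambda>n. Re (of_real (p n * \<phi> n) * y n * cnj a)) sums Re (c * cnj a)"
    by (rule sums_Re)
  then have "(\<lambda>n. p n * (norm (y n))\<^sup>2 - 2 * Re (of_real (p n * \<phi> n) * y n * cnj a)
       + p n * (\<phi> n)\<^sup>2 * (norm a)\<^sup>2) sums (Y - 2 * Re (c * cnj a) + \<nu> * (norm a)\<^sup>2)"
    by (intro sums_add sums_diff sums_mult sums_mult2 Y \<nu>)
  moreover have "p n * (norm (y n - a * of_real (\<phi> n)))\<^sup>2 =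
     p n * (norm (y n))\<^sup>2 - 2 * Re (of_real (p n * \<phi> n) * y n * cnj a) + p n * (\<phi> n)\<^sup>2 * (norm a)\<^sup>2" for n
    by (simp only: cmod_power2) (simp add: algebra_simps power2_eq_square)
  ultimately show ?thesis by simp
qed

text \<open>
  Riesz-Fischer for a complete orthogonal system, in a form that returns the squared error \<open>\<tau> N\<close> of the
  partial sums.  Bessel's inequality makes the remainders \<open>R N\<close> a Cauchy sequence in the weighted norm; they
  converge pointwise to some \<open>\<rho>\<close>, and passing to the limit in finite sums shows that the convergence also
  holds in norm.  Hence \<open>\<rho>\<close> is orthogonal to the whole system, so it vanishes by completeness.
\<close>
lemma orthogonal_expansion_converges:
  fixes p :: "nat \<Rightarrow> real" and \<phi> :: "nat \<Rightarrow> nat \<Rightarrow> real" and x a :: "nat \<Rightarrow> complex"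
  assumes p: "\<And>n. 0 < p n"
    and orth: "\<And>j k. (\<lambda>n. p n * (\<phi> j n * \<phi> k n)) sums (if j = k then \<nu> k else 0)"
    and complete: "\<And>y. summable (\<lambda>n. p n * (norm (y n))\<^sup>2) \<Longrightarrow>
                    (\<And>k. (\<lambda>n. of_real (p n * \<phi> k n) * y n) sums 0) \<Longrightarrow> (\<And>n. y n = (0 :: complex))"
    and x: "summable (\<lambda>n. p n * (norm (x n))\<^sup>2)"
    and a: "\<And>k. (\<lambda>n. of_real (p n * \<phi> k n) * x n) sums (of_real (\<nu> k) * a k)"
  shows "\<exists>\<tau>. \<tau> \<longlonglongrightarrow> 0 \<and>
    (\<forall>N. (\<lambda>n. p n * (norm (x n - (\<Sum>k<N. a k * of_real (\<phi> k n))))\<^sup>2) sums \<tau> N)"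
proof -
  define R where "R N n = x n - (\<Sum>k<N. a k * of_real (\<phi> k n))" for N n
  define b where "b k = \<nu> k * (norm (a k))\<^sup>2" for k
  define X where "X = (\<Sum>n. p n * (norm (x n))\<^sup>2)"
  have R_Suc: "R (Suc N) n = R N n - a N * of_real (\<phi> N n)" for N n
    by (simp add: R_def)
  have sq: "(\<lambda>n. p n * (\<phi> k n)\<^sup>2) sums \<nu> k" for k
    using orth[of k k] by (simp add: power2_eq_square)
  have \<nu>: "\<nu> k \<ge> 0" for k
    using sums_le[OF _ sums_zero sq[of k]] p by (auto simp: less_imp_le)
  then have b: "b k \<ge> 0" for k by (simp add: b_def)
  have pair: "(\<lambda>n. of_real (p n * \<phi> k n) * R N n) sums (if k < N then 0 else of_real (\<nu> k) * a k)" for k N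
  proof (induction N)
    case 0
    then show ?case using a by (simp add: R_def)
  next
    case (Suc N)
    have "(\<lambda>n. complex_of_real (p n * (\<phi> k n * \<phi> N n))) sums of_real (if k = N then \<nu> N else 0)"
      by (rule sums_of_real[OF orth])
    then have "(\<lambda>n. of_real (p n * \<phi> k n) * R N n - of_real (p n * (\<phi> k n * \<phi> N n)) * a N) sums
       ((if k < N then 0 else of_real (\<nu> k) * a k) - of_real (if k = N then \<nu> N else 0) * a N)"
      by (intro sums_diff sums_mult2 Suc)
    moreover have "of_real (p n * \<phi> k n) * R N n - of_real (p n * (\<phi> k n * \<phi> N n)) * a N
        = of_real (p n * \<phi> k n) * R (Suc N) n" for n
      by (simp add: R_Suc algebra_simps)
    moreover have "(if k < N then 0 else of_real (\<nu> k) * a k) - of_real (if k = N then \<nu> N else 0) * a N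
        = (if k < Suc N then 0 else of_real (\<nu> k) * a k)" by (auto simp: less_Suc_eq)
    ultimately show ?case by simp
  qed
  have energy: "(\<lambda>n. p n * (norm (R N n))\<^sup>2) sums (X - (\<Sum>k<N. b k))" for N
  proof (induction N)
    case 0
    then show ?case using x by (simp add: R_def X_def summable_sums)
  next
    case (Suc N)
    have "Re (of_real (\<nu> N) * a N * cnj (a N)) = b N"
      unfolding b_def cmod_power2 by (simp add: power2_eq_square algebra_simps)
    then have eq: "X - (\<Sum>k<N. b k) - 2 * Re (of_real (\<nu> N) * a N * cnj (a N)) + \<nu> N * (norm (a N))\<^sup>2
         = X - (\<Sum>k<Suc N. b k)"
      by (simp add: b_def)
    have "(\<lambda>n. of_real (p n * \<phi> N n) * R N n) sums (of_real (\<nu> N) * a N)"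
      using pair[of N N] by simp
    from weighted_norm_subtract_multiple[OF Suc this sq, of "a N"]
    show ?case by (simp only: R_Suc eq)
  qed
  have "(\<Sum>k<N. b k) \<le> X" for N
    using sums_le[OF _ sums_zero energy[of N]] p by (auto simp: less_imp_le)
  then have b_summable: "summable b"
    using b by (intro summableI_nonneg_bounded) auto
  define T where "T N = suminf b - (\<Sum>k<N. b k)" for N
  have T_lim: "T \<longlonglongrightarrow> 0"
    unfolding T_def[abs_def] using summable_LIMSEQ[OF b_summable]
    by (intro tendsto_eq_intros) auto
  have diff: "(\<lambda>n. p n * (norm (R N n - R (N + m) n))\<^sup>2) sums (\<Sum>k<m. b (N + k))" for N m
  proof (induction m)
    case (Suc m)
    have "(\<lambda>n. of_real (p n * \<phi> (N + m) n) * R N n - of_real (p n * \<phi> (N + m) n) * R (N + m) n)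
            sums (of_real (\<nu> (N + m)) * a (N + m) - of_real (\<nu> (N + m)) * a (N + m))"
      using pair[of "N + m" N] pair[of "N + m" "N + m"] by (intro sums_diff) auto
    then have "(\<lambda>n. of_real (p n * \<phi> (N + m) n) * (R N n - R (N + m) n)) sums 0"
      by (simp add: right_diff_distrib)
    from weighted_norm_subtract_multiple[OF Suc this sq, of "- a (N + m)"]
    show ?case by (simp add: R_Suc b_def algebra_simps)
  qed simp
  have diff_le: "(\<Sum>n<K. p n * (norm (R N n - R M n))\<^sup>2) \<le> T N" if NM: "N \<le> M" for N M K
  proof -
    obtain m where M: "M = N + m" using le_Suc_ex[OF NM] by auto
    have "(\<Sum>n<K. p n * (norm (R N n - R M n))\<^sup>2) \<le> (\<Sum>k<m. b (N + k))"
      unfolding M sums_unique[OF diff] using p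
      by (intro sum_le_suminf) (auto simp: sums_summable[OF diff] less_imp_le)
    also have "\<dots> = (\<Sum>k<N + m. b k) - (\<Sum>k<N. b k)"
      by (induction m) simp_all
    also have "\<dots> \<le> T N"
      unfolding T_def using b b_summable by (auto intro: sum_le_suminf)
    finally show ?thesis .
  qed
  have "Cauchy (\<lambda>N. R N n)" for n
  proof (rule CauchyI')
    fix e :: real assume e: "e > 0"
    have "eventually (\<lambda>N. T N < p n * e\<^sup>2) sequentially"
      using order_tendstoD(2)[OF T_lim, of "p n * e\<^sup>2"] p[of n] e by simp
    then obtain N0 where N0: "\<And>N. N \<ge> N0 \<Longrightarrow> T N < p n * e\<^sup>2"
      by (auto simp: eventually_sequentially)
    show "\<exists>M. \<forall>m\<ge>M. \<forall>k>m. dist (R m n) (R k n) < e"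
    proof (intro exI allI impI)
      fix m k assume mk: "m \<ge> N0" "m < k"
      have "p n * (norm (R m n - R k n))\<^sup>2 \<le> (\<Sum>i<Suc n. p i * (norm (R m i - R k i))\<^sup>2)"
        using p by (intro member_le_sum) (auto simp: less_imp_le)
      also have "\<dots> \<le> T m" using mk by (intro diff_le) simp
      also have "\<dots> < p n * e\<^sup>2" using mk N0 by simp
      finally have "(norm (R m n - R k n))\<^sup>2 < e\<^sup>2" using p[of n] by simp
      then show "dist (R m n) (R k n) < e"
        using e by (simp add: dist_norm power_less_imp_less_base)
    qed
  qed
  then have "\<forall>n. \<exists>l. (\<lambda>N. R N n) \<longlonglongrightarrow> l"
    by (simp add: Cauchy_convergent_iff convergent_def)
  then obtain \<rho> where \<rho>: "\<And>n. (\<lambda>N. R N n) \<longlonglongrightarrow> \<rho> n" by metis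
  have \<rho>_le: "(\<Sum>n<K. p n * (norm (R N n - \<rho> n))\<^sup>2) \<le> T N" for N K
  proof (rule LIMSEQ_le_const2)
    show "(\<lambda>M. \<Sum>n<K. p n * (norm (R N n - R M n))\<^sup>2) \<longlonglongrightarrow> (\<Sum>n<K. p n * (norm (R N n - \<rho> n))\<^sup>2)"
      by (intro tendsto_intros \<rho>)
    show "\<exists>M. \<forall>n\<ge>M. (\<Sum>i<K. p i * (norm (R N i - R n i))\<^sup>2) \<le> T N"
      using diff_le by blast
  qed
  have \<rho>_summable: "summable (\<lambda>n. p n * (norm (R N n - \<rho> n))\<^sup>2)" for N
    using p \<rho>_le by (intro summableI_nonneg_bounded) (auto simp: less_imp_le)
  have \<rho>_suminf: "(\<Sum>n. p n * (norm (R N n - \<rho> n))\<^sup>2) \<le> T N" for N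
    using \<rho>_summable \<rho>_le by (intro suminf_le_const) auto
  have "\<rho> n = 0" for n
  proof (rule complete)
    have "summable (\<lambda>n. 2 * (p n * (norm (R 0 n - \<rho> n))\<^sup>2) + 2 * (p n * (norm (x n))\<^sup>2))"
      by (intro summable_add summable_mult \<rho>_summable x)
    then show "summable (\<lambda>n. p n * (norm (\<rho> n))\<^sup>2)"
    proof (rule summable_comparison_test'[where N = 0])
      fix n
      have "(norm (\<rho> n))\<^sup>2 \<le> (norm (R 0 n - \<rho> n) + norm (x n))\<^sup>2"
        using norm_triangle_ineq4[of "x n" "x n - \<rho> n"]
        by (intro power_mono) (simp_all add: R_def algebra_simps)
      also have "\<dots> \<le> 2 * (norm (R 0 n - \<rho> n))\<^sup>2 + 2 * (norm (x n))\<^sup>2"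
        using sum_squares_bound[of "norm (R 0 n - \<rho> n)" "norm (x n)"]
        by (simp add: power2_eq_square algebra_simps)
      finally have "p n * (norm (\<rho> n))\<^sup>2 \<le> p n * (2 * (norm (R 0 n - \<rho> n))\<^sup>2 + 2 * (norm (x n))\<^sup>2)"
        using p[of n] by (intro mult_left_mono) auto
      then show "norm (p n * (norm (\<rho> n))\<^sup>2)
          \<le> 2 * (p n * (norm (R 0 n - \<rho> n))\<^sup>2) + 2 * (p n * (norm (x n))\<^sup>2)"
        using p[of n] by (simp add: algebra_simps)
    qed
    fix k
    note CS = weighted_Cauchy_Schwarz[OF less_imp_le[OF p] sq summable_sums[OF \<rho>_summable]]
    define d where "d N = (\<Sum>n. of_real (p n * \<phi> k n) * (R N n - \<rho> n))" for N
    have d_sums: "(\<lambda>n. of_real (p n * \<phi> k n) * (R N n - \<rho> n)) sums d N" for N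
      unfolding d_def by (rule summable_sums[OF summable_norm_cancel[OF CS(1)]])
    have pair_\<rho>: "(\<lambda>n. of_real (p n * \<phi> k n) * \<rho> n) sums (- d N)" if "k < N" for N
    proof -
      have "(\<lambda>n. of_real (p n * \<phi> k n) * R N n - of_real (p n * \<phi> k n) * (R N n - \<rho> n)) sums (0 - d N)"
        using pair[of k N] that by (intro sums_diff d_sums) simp
      then show ?thesis by (simp add: right_diff_distrib)
    qed
    have d_const: "d N = d (Suc k)" if "k < N" for N
      using sums_unique2[OF pair_\<rho>[OF that] pair_\<rho>[of "Suc k"]] by simp
    have d_le: "(norm (d N))\<^sup>2 \<le> \<nu> k * T N" for N
    proof -
      have "(norm (d N))\<^sup>2 \<le> (\<Sum>n. norm (of_real (p n * \<phi> k n) * (R N n - \<rho> n)))\<^sup>2"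
        unfolding d_def by (intro power_mono summable_norm CS(1)) simp
      also have "\<dots> \<le> \<nu> k * (\<Sum>n. p n * (norm (R N n - \<rho> n))\<^sup>2)" by (rule CS(2))
      also have "\<dots> \<le> \<nu> k * T N" by (intro mult_left_mono \<rho>_suminf \<nu>)
      finally show ?thesis .
    qed
    have "(norm (d (Suc k)))\<^sup>2 \<le> \<nu> k * 0"
    proof (rule LIMSEQ_le_const)
      show "(\<lambda>N. \<nu> k * T N) \<longlonglongrightarrow> \<nu> k * 0" by (intro tendsto_intros T_lim)
      show "\<exists>N. \<forall>n\<ge>N. (norm (d (Suc k)))\<^sup>2 \<le> \<nu> k * T n"
        using d_le d_const by (metis less_eq_Suc_le)
    qed
    then show "(\<lambda>n. of_real (p n * \<phi> k n) * \<rho> n) sums 0"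
      using pair_\<rho>[of "Suc k"] by simp
  qed
  then have "X - (\<Sum>k<N. b k) \<le> T N" "0 \<le> X - (\<Sum>k<N. b k)" for N
    using \<rho>_suminf[of N] sums_unique[OF energy[of N]] \<open>(\<Sum>k<N. b k) \<le> X\<close> by simp_all
  then have "(\<lambda>N. X - (\<Sum>k<N. b k)) \<longlonglongrightarrow> 0"
    by (intro tendsto_sandwich[OF _ _ tendsto_const T_lim]) auto
  then show ?thesis using energy unfolding R_def by blast
qed

section \<open>Cosine and sine on the grid\<close>

context qtrig
begin

text \<open>
  \<open>gcos w\<close> lives at the points \<open>q\<^sup>n\<close> with frequency \<open>q\<^sup>1\<^sup>/\<^sup>2 w\<close>, whereas \<open>gsin w\<close> starts one grid point earlier: its
  value at \<open>0\<close> is \<open>S\<^sub>q w\<close>, the boundary value, and its value at \<open>Suc n\<close> is the sine function of the Fourier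
  series at \<open>q\<^sup>n\<close>.
\<close>
definition gcos :: "complex \<Rightarrow> nat \<Rightarrow> complex" where
  "gcos w n = qcos q (of_real (r * q ^ n) * w)"

definition gsin :: "complex \<Rightarrow> nat \<Rightarrow> complex" where
  "gsin w n = qsin q (of_real (q ^ n) * w)"

lemma gsin_0: "gsin w 0 = qsin q w" and gcos_0: "gcos w 0 = qcos q (of_real r * w)"
  by (simp_all add: gsin_def gcos_def)

lemma gsin_diff: "gsin w n - gsin w (Suc n) = w * of_real (q ^ n) * gcos w n"
  using qsin_diff[of "of_real (q ^ n) * w"] by (simp add: gsin_def gcos_def mult_ac)

lemma gcos_diff: "gcos w n - gcos w (Suc n) = - (of_real r * w * of_real (q ^ n) * gsin w (Suc n))"
proof -
  define z where "z = of_real (r * q ^ n) * w"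
  have "of_real r * z = of_real ((r * r) * q ^ n) * w"
    by (simp only: z_def of_real_mult mult.assoc)
  then have 1: "of_real r * z = of_real (q ^ Suc n) * w" by (simp only: r_sq power_Suc)
  have 2: "of_real q * z = of_real (r * q ^ Suc n) * w" by (simp add: z_def)
  have 3: "z = of_real r * w * of_real (q ^ n)" by (simp add: z_def)
  show ?thesis
    using qcos_diff[of z] unfolding 1 2 gsin_def gcos_def z_def[symmetric] by (simp add: 3)
qed

lemma q_power_tendsto_0: "(\<lambda>n. q ^ n) \<longlonglongrightarrow> 0"
  using q_pos q_less_1 by (intro LIMSEQ_realpow_zero) auto

lemma q_power_le_1: "q ^ n \<le> 1"
  using q_pos q_less_1 by (simp add: power_le_one)

lemma gsin_tendsto: "gsin w \<longlonglongrightarrow> 0" and gcos_tendsto: "gcos w \<longlonglongrightarrow> 1"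
proof -
  have S: "isCont (qsin q) 0" and C: "isCont (qcos q) 0"
    using holomorphic_on_imp_continuous_on[OF qsin_holomorphic[of UNIV]]
      holomorphic_on_imp_continuous_on[OF qcos_holomorphic[of UNIV]]
    by (simp_all add: continuous_on_eq_continuous_at)
  have "(\<lambda>n. of_real (q ^ n) * w) \<longlonglongrightarrow> of_real 0 * w"
    "(\<lambda>n. of_real (r * q ^ n) * w) \<longlonglongrightarrow> of_real (r * 0) * w"
    by (intro tendsto_intros q_power_tendsto_0)+
  then have "(\<lambda>n. qsin q (of_real (q ^ n) * w)) \<longlonglongrightarrow> qsin q 0"
    "(\<lambda>n. qcos q (of_real (r * q ^ n) * w)) \<longlonglongrightarrow> qcos q 0"
    by (auto intro!: isCont_tendsto_compose[OF S] isCont_tendsto_compose[OF C])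
  then show "gsin w \<longlonglongrightarrow> 0" "gcos w \<longlonglongrightarrow> 1"
    by (simp_all add: gsin_def[abs_def] gcos_def[abs_def] qsin_0 qcos_0)
qed

lemma gsin_Suc_tendsto: "(\<lambda>n. gsin w (Suc n)) \<longlonglongrightarrow> 0"
  by (rule LIMSEQ_Suc[OF gsin_tendsto])

lemma summable_q_power_times_bounded:
  fixes u :: "nat \<Rightarrow> complex"
  assumes "Bseq u"
  shows "summable (\<lambda>n. norm (of_real (q ^ n) * u n))"
proof -
  obtain K where "\<And>n. norm (u n) \<le> K" using assms by (auto simp: Bseq_def)
  then have "norm (norm (of_real (q ^ n) * u n)) \<le> q ^ n * K" for n
    using q_pos by (simp add: norm_mult norm_power mult_left_mono)
  moreover have "summable (\<lambda>n. q ^ n * K)"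
    using q_pos q_less_1 by (intro summable_mult2 summable_geometric) simp
  ultimately show ?thesis by (rule summable_comparison_test'[where N = 0, rotated])
qed

lemma Bseq_convergent: "(u :: nat \<Rightarrow> complex) \<longlonglongrightarrow> l \<Longrightarrow> Bseq u"
  by (rule convergent_imp_Bseq) (auto simp: convergent_def)

lemma summable_pairing:
  fixes u v :: "nat \<Rightarrow> complex"
  assumes "u \<longlonglongrightarrow> a" "v \<longlonglongrightarrow> b"
  shows "summable (\<lambda>n. of_real (q ^ n) * (u n * v n))"
  by (intro summable_norm_cancel[OF summable_q_power_times_bounded] Bseq_convergent[OF tendsto_mult[OF assms]])

definition cos_pairing :: "complex \<Rightarrow> complex \<Rightarrow> complex" where
  "cos_pairing w w' = (\<Sum>n. of_real (q ^ n) * (gcos w n * gcos w' n))"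

definition sin_pairing :: "complex \<Rightarrow> complex \<Rightarrow> complex" where
  "sin_pairing w w' = (\<Sum>n. of_real (q ^ n) * (gsin w (Suc n) * gsin w' (Suc n)))"

lemma cos_pairing_sums: "(\<lambda>n. of_real (q ^ n) * (gcos w n * gcos w' n)) sums cos_pairing w w'"
  unfolding cos_pairing_def by (intro summable_sums summable_pairing[OF gcos_tendsto gcos_tendsto])

lemma sin_pairing_sums:
  "(\<lambda>n. of_real (q ^ n) * (gsin w (Suc n) * gsin w' (Suc n))) sums sin_pairing w w'"
  unfolding sin_pairing_def
  by (intro summable_sums summable_pairing[OF gsin_Suc_tendsto gsin_Suc_tendsto])

lemma cos_pairing_commute: "cos_pairing w w' = cos_pairing w' w"
  and sin_pairing_commute: "sin_pairing w w' = sin_pairing w' w"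
  by (simp_all add: cos_pairing_def sin_pairing_def mult.commute)

text \<open>
  The Lagrange identity of the difference system: summation by parts moves the difference from the sine
  function of \<open>w\<close> to the cosine function of \<open>w'\<close>, and the boundary term carries the factor \<open>S\<^sub>q w\<close>.
\<close>
lemma pairing_relation:
  "w * cos_pairing w w' = qsin q w * qcos q (of_real r * w') + of_real r * w' * sin_pairing w w'"
proof -
  have "(\<lambda>n. (gsin w n - gsin w (Suc n)) * gcos w' n) sums
          (gsin w 0 * gcos w' 0 + of_real r * w' * sin_pairing w w')"
  proof (rule sums_by_parts)
    show "(\<lambda>n. gsin w n * gcos w' n) \<longlonglongrightarrow> 0"
      using tendsto_mult[OF gsin_tendsto gcos_tendsto] by simp
    have "gsin w (Suc n) * (gcos w' (Suc n) - gcos w' n)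
        = of_real r * w' * (of_real (q ^ n) * (gsin w (Suc n) * gsin w' (Suc n)))" for n
    proof -
      have "gcos w' (Suc n) - gcos w' n = of_real r * w' * of_real (q ^ n) * gsin w' (Suc n)"
        by (metis gcos_diff minus_diff_eq minus_minus)
      then show ?thesis by (simp add: mult_ac)
    qed
    then show "(\<lambda>n. gsin w (Suc n) * (gcos w' (Suc n) - gcos w' n)) sums
        (of_real r * w' * sin_pairing w w')"
      by (simp only:) (intro sums_mult sin_pairing_sums)
  qed
  moreover have "(\<lambda>n. (gsin w n - gsin w (Suc n)) * gcos w' n) sums (w * cos_pairing w w')"
    using sums_mult[OF cos_pairing_sums, of w w w'] by (simp add: gsin_diff mult_ac)
  ultimately show ?thesis unfolding gsin_0 gcos_0 by (metis sums_unique2)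
qed

definition cos_norm2 :: "complex \<Rightarrow> real" where
  "cos_norm2 w = (\<Sum>n. q ^ n * (norm (gcos w n))\<^sup>2)"

definition sin_norm2 :: "complex \<Rightarrow> real" where
  "sin_norm2 w = (\<Sum>n. q ^ n * (norm (gsin w (Suc n)))\<^sup>2)"

lemma cnj_gcos: "cnj (gcos w n) = gcos (cnj w) n" and cnj_gsin: "cnj (gsin w n) = gsin (cnj w) n"
  by (simp_all add: gcos_def gsin_def cnj_qcos cnj_qsin)

lemma cos_norm2_sums: "(\<lambda>n. q ^ n * (norm (gcos w n))\<^sup>2) sums cos_norm2 w"
  and cos_pairing_cnj: "cos_pairing w (cnj w) = of_real (cos_norm2 w)"
proof -
  have eq: "of_real (q ^ n) * (gcos w n * gcos (cnj w) n) = of_real (q ^ n * (norm (gcos w n))\<^sup>2)" for n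
    by (simp only: of_real_mult complex_norm_square cnj_gcos)
  show *: "(\<lambda>n. q ^ n * (norm (gcos w n))\<^sup>2) sums cos_norm2 w"
    unfolding cos_norm2_def
    using sums_summable[OF cos_pairing_sums[of w "cnj w"]] unfolding eq
    by (intro summable_sums) (simp only: summable_complex_of_real)
  show "cos_pairing w (cnj w) = of_real (cos_norm2 w)"
    using cos_pairing_sums[of w "cnj w"] sums_of_real[OF *] unfolding eq by (rule sums_unique2)
qed

lemma sin_norm2_sums: "(\<lambda>n. q ^ n * (norm (gsin w (Suc n)))\<^sup>2) sums sin_norm2 w"
  and sin_pairing_cnj: "sin_pairing w (cnj w) = of_real (sin_norm2 w)"
proof -
  have eq: "of_real (q ^ n) * (gsin w (Suc n) * gsin (cnj w) (Suc n))
      = of_real (q ^ n * (norm (gsin w (Suc n)))\<^sup>2)" for n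
    by (simp only: of_real_mult complex_norm_square cnj_gsin)
  show *: "(\<lambda>n. q ^ n * (norm (gsin w (Suc n)))\<^sup>2) sums sin_norm2 w"
    unfolding sin_norm2_def
    using sums_summable[OF sin_pairing_sums[of w "cnj w"]] unfolding eq
    by (intro summable_sums) (simp only: summable_complex_of_real)
  show "sin_pairing w (cnj w) = of_real (sin_norm2 w)"
    using sin_pairing_sums[of w "cnj w"] sums_of_real[OF *] unfolding eq by (rule sums_unique2)
qed

lemma cos_norm2_pos: "cos_norm2 w > 0"
proof -
  have "eventually (\<lambda>n. gcos w n \<noteq> 0) sequentially"
    by (rule tendsto_imp_eventually_ne[OF gcos_tendsto]) simp
  then obtain n where "gcos w n \<noteq> 0" by (auto simp: eventually_sequentially)
  then show ?thesis
    unfolding cos_norm2_def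
    using q_pos by (intro suminf_pos2[where i = n] sums_summable[OF cos_norm2_sums]) auto
qed

text \<open>
  For \<open>w' = cnj w\<close> both pairings are squared norms, and the relation reads \<open>w P = r (cnj w) Q\<close> with \<open>P\<close> positive.
  Comparing moduli gives \<open>P = r Q\<close>, and then \<open>w = cnj w\<close>.
\<close>
lemma qsin_zero_norms:
  assumes "qsin q w = 0" "w \<noteq> 0"
  shows "w \<in> \<real>" and "cos_norm2 w = r * sin_norm2 w"
proof -
  have eq: "w * of_real (cos_norm2 w) = of_real r * cnj w * of_real (sin_norm2 w)"
    using pairing_relation[of w "cnj w"] assms(1) by (simp add: cos_pairing_cnj sin_pairing_cnj)
  have "sin_norm2 w \<ge> 0"
    unfolding sin_norm2_def using q_pos
    by (intro suminf_nonneg sums_summable[OF sin_norm2_sums]) auto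
  then have "norm w * cos_norm2 w = norm w * (r * sin_norm2 w)"
    using arg_cong[OF eq, of norm] cos_norm2_pos[of w] r_pos by (simp add: norm_mult abs_mult)
  then show *: "cos_norm2 w = r * sin_norm2 w" using assms(2) by simp
  have "w * of_real (cos_norm2 w) = cnj w * of_real (cos_norm2 w)"
    using eq unfolding * by (simp add: mult_ac)
  then have "w = cnj w" using cos_norm2_pos[of w] by simp
  then show "w \<in> \<real>" using Reals_cnj_iff by metis
qed

text \<open>
  The relations for \<open>(w, w')\<close> and for \<open>(w', w)\<close> form a homogeneous linear system in the two pairings with
  determinant a multiple of \<open>w\<^sup>2 - w'\<^sup>2\<close>.
\<close>
lemma qsin_zeros_orthogonal:
  assumes "qsin q w = 0" "qsin q w' = 0" "w\<^sup>2 \<noteq> w'\<^sup>2"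
  shows "sin_pairing w w' = 0" and "w \<noteq> 0 \<Longrightarrow> cos_pairing w w' = 0"
proof -
  have 1: "w * cos_pairing w w' = of_real r * w' * sin_pairing w w'"
    and 2: "w' * cos_pairing w w' = of_real r * w * sin_pairing w w'"
    using pairing_relation[of w w'] pairing_relation[of w' w] assms(1,2)
    by (simp_all add: cos_pairing_commute[of w'] sin_pairing_commute[of w'])
  have "of_real r * (w\<^sup>2 - w'\<^sup>2) * sin_pairing w w' = 0"
    using arg_cong[OF 1, of "\<lambda>z. w' * z"] arg_cong[OF 2, of "\<lambda>z. w * z"]
    by (simp add: algebra_simps power2_eq_square)
  then show *: "sin_pairing w w' = 0" using assms(3) q_pos by simp
  show "cos_pairing w w' = 0" if "w \<noteq> 0" using 1 that unfolding * by simp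
qed

text \<open>
  Eliminating the sine pairing of \<open>v\<close> and the zero \<open>w\<close> gives
  \<open>(v\<^sup>2 - w\<^sup>2) P(v, w) = v S\<^sub>q(v) C\<^sub>q(r w)\<close> for all \<open>v\<close>; the claim is the derivative of this identity at \<open>v = w\<close>.
  It yields the simplicity of the zeros and the value of \<open>\<mu>\<^sub>k\<close>.
\<close>
lemma deriv_qsin_at_zero:
  assumes "qsin q w = 0" "w \<noteq> 0"
  shows "deriv (qsin q) w * qcos q (of_real r * w) = 2 * of_real (cos_norm2 w)"
proof -
  have w: "cnj w = w" using qsin_zero_norms(1)[OF assms] by (simp add: Reals_cnj_iff)
  have "summable (\<lambda>n. norm (of_real (q ^ n) * gcos w n))"
    by (rule summable_q_power_times_bounded[OF Bseq_convergent[OF gcos_tendsto]])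
  then have "(\<lambda>v. \<Sum>n. (of_real (q ^ n) * gcos w n) * qcos q (of_real (r * q ^ n) * v)) holomorphic_on UNIV"
    using r_pos r_less_1 q_pos q_power_le_1
    by (intro entire_series_dilations qcos_holomorphic) (auto simp: abs_mult intro!: mult_le_one)
  moreover have "(\<Sum>n. (of_real (q ^ n) * gcos w n) * qcos q (of_real (r * q ^ n) * v)) = cos_pairing v w" for v
    unfolding cos_pairing_def gcos_def[of v] by (simp add: mult_ac)
  ultimately have hol: "(\<lambda>v. cos_pairing v w) holomorphic_on UNIV" by simp
  obtain P' where P': "((\<lambda>v. cos_pairing v w) has_field_derivative P') (at w)"
    using hol by (auto simp: holomorphic_on_def field_differentiable_def)
  have S': "(qsin q has_field_derivative deriv (qsin q) w) (at w)"
    using qsin_holomorphic[of UNIV] by (simp add: holomorphic_derivI)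
  have eq: "(v\<^sup>2 - w\<^sup>2) * cos_pairing v w = v * qsin q v * qcos q (of_real r * w)" for v
  proof -
    have 1: "v * cos_pairing v w = qsin q v * qcos q (of_real r * w) + of_real r * w * sin_pairing v w"
      and 2: "w * cos_pairing v w = of_real r * v * sin_pairing v w"
      using pairing_relation[of v w] pairing_relation[of w v] assms(1)
      by (simp_all add: cos_pairing_commute[of w] sin_pairing_commute[of w])
    have "(v\<^sup>2 - w\<^sup>2) * cos_pairing v w = v * (v * cos_pairing v w) - w * (w * cos_pairing v w)"
      by (simp add: algebra_simps power2_eq_square)
    also have "\<dots> = v * qsin q v * qcos q (of_real r * w)"
      unfolding 1 2 by (simp add: algebra_simps)
    finally show ?thesis .
  qed
  have "((\<lambda>v. (v\<^sup>2 - w\<^sup>2) * cos_pairing v w) has_field_derivative 2 * w * cos_pairing w w) (at w)"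
    by (rule derivative_eq_intros P' refl | simp)+
  moreover have "((\<lambda>v. v * qsin q v * qcos q (of_real r * w)) has_field_derivative
      w * deriv (qsin q) w * qcos q (of_real r * w)) (at w)"
    by (rule derivative_eq_intros S' refl | simp add: assms)+
  ultimately have "2 * w * cos_pairing w w = w * deriv (qsin q) w * qcos q (of_real r * w)"
    unfolding eq using DERIV_unique by blast
  then show ?thesis using assms(2) cos_pairing_cnj[of w] unfolding w by simp
qed

lemma qsin_zeros_simple:
  assumes "qsin q w = 0" shows "deriv (qsin q) w \<noteq> 0"
proof (cases "w = 0")
  case True then show ?thesis using deriv_qsin_0 by simp
next
  case False
  then show ?thesis using deriv_qsin_at_zero[OF assms] cos_norm2_pos[of w] by auto
qed

section \<open>Completeness of the sine system\<close>

text \<open>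
  The pair \<open>(y, x)\<close> solves the difference system of \<open>(gsin w, gcos w)\<close> with the additional source \<open>g\<close> in the
  second equation, starting from the boundary value \<open>y = 0\<close> and from \<open>x = \<beta>\<close>.
\<close>
primrec resolvent :: "complex \<Rightarrow> (nat \<Rightarrow> complex) \<Rightarrow> complex \<Rightarrow> nat \<Rightarrow> complex \<times> complex" where
  "resolvent w g \<beta> 0 = (0, \<beta>)"
| "resolvent w g \<beta> (Suc n) = (let (y, x) = resolvent w g \<beta> n; y' = y - w * of_real (q ^ n) * x
     in (y', x + of_real r * w * of_real (q ^ n) * y' - of_real (q ^ n) * g n))"

lemma resolvent_Suc:
  "fst (resolvent w g \<beta> (Suc n)) =
     fst (resolvent w g \<beta> n) - w * of_real (q ^ n) * snd (resolvent w g \<beta> n)"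
  "snd (resolvent w g \<beta> (Suc n)) = snd (resolvent w g \<beta> n)
     + of_real r * w * of_real (q ^ n) * fst (resolvent w g \<beta> (Suc n)) - of_real (q ^ n) * g n"
  by (simp_all add: Let_def split_beta)

text \<open>
  A weighted square summable \<open>g\<close> satisfies \<open>q\<^sup>n \<bar>g n\<bar> \<le> B r\<^sup>n\<close>, so one step of the recursion multiplies
  \<open>1 + \<bar>x\<bar> + \<bar>y\<bar>\<close> by at most \<open>1 + L r\<^sup>n\<close>.
\<close>
lemma resolvent_bounded:
  assumes g: "(\<lambda>n. q ^ n * (norm (g n))\<^sup>2) sums \<Gamma>"
  obtains K where "\<And>n. norm (fst (resolvent w g \<beta> n)) \<le> K" "\<And>n. norm (snd (resolvent w g \<beta> n)) \<le> K"
proof -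
  define y x where "y n = fst (resolvent w g \<beta> n)" and "x n = snd (resolvent w g \<beta> n)" for n
  note yS = resolvent_Suc(1)[of w g \<beta>, folded y_def x_def]
  note xS = resolvent_Suc(2)[of w g \<beta>, folded y_def x_def]
  define B where "B = sqrt \<Gamma>"
  have qr: "q ^ n = r ^ n * r ^ n" for n using r_sq by (simp flip: power_mult_distrib)
  have rn: "0 < r ^ n" "r ^ n \<le> 1" for n using r_pos r_less_1 by (auto intro: power_le_one)
  have gB: "q ^ n * norm (g n) \<le> B * r ^ n" for n
  proof -
    have "(r ^ n * norm (g n))\<^sup>2 = q ^ n * (norm (g n))\<^sup>2"
      unfolding qr by (simp add: power2_eq_square)
    also have "\<dots> \<le> \<Gamma>"
      unfolding sums_unique[OF g]
      using sum_le_suminf[OF sums_summable[OF g], of "{n}"] q_pos by auto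
    finally have "r ^ n * norm (g n) \<le> B" unfolding B_def by (rule real_le_rsqrt)
    then have "r ^ n * (r ^ n * norm (g n)) \<le> r ^ n * B" by (rule mult_left_mono[OF _ less_imp_le[OF rn(1)]])
    then show ?thesis unfolding qr by (simp add: mult_ac)
  qed
  have B: "B \<ge> 0" using sums_le[OF _ sums_zero g] q_pos by (simp add: B_def)
  define m where "m n = 1 + norm (x n) + norm (y n)" for n
  define L where "L = B + norm w + (norm w)\<^sup>2"
  have L: "L \<ge> 0" using B by (simp add: L_def)
  have q_le: "norm w * q ^ n * c \<le> norm w * r ^ n * c" if "c \<ge> 0" for c n
    using rn[of n] that unfolding qr by (intro mult_right_mono mult_left_mono) (auto intro: mult_left_le)
  have step: "m (Suc n) \<le> (1 + L * r ^ n) * m n" for n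
  proof -
    have y': "norm (y (Suc n)) \<le> norm (y n) + norm w * r ^ n * norm (x n)"
    proof -
      have "norm (y (Suc n)) \<le> norm (y n) + norm w * q ^ n * norm (x n)"
        unfolding yS using norm_triangle_ineq4[of "y n" "w * of_real (q ^ n) * x n"] q_pos
        by (simp add: norm_mult norm_power)
      then show ?thesis using q_le[of "norm (x n)" n] by simp
    qed
    have x': "norm (x (Suc n)) \<le> norm (x n) + norm w * r ^ n * norm (y (Suc n)) + B * r ^ n"
    proof -
      have "norm (x (Suc n)) \<le> norm (x n) + norm (of_real r * w * of_real (q ^ n) * y (Suc n))
          + norm (of_real (q ^ n) * g n)"
        unfolding xS
        using norm_triangle_ineq4[of "x n + of_real r * w * of_real (q ^ n) * y (Suc n)" "of_real (q ^ n) * g n"]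
          norm_triangle_ineq[of "x n" "of_real r * w * of_real (q ^ n) * y (Suc n)"]
        by linarith
      moreover have "norm (of_real r * w * of_real (q ^ n) * y (Suc n)) = r * (norm w * q ^ n * norm (y (Suc n)))"
        using q_pos by (simp add: norm_mult norm_power)
      moreover have "r * (norm w * q ^ n * norm (y (Suc n))) \<le> norm w * r ^ n * norm (y (Suc n))"
      proof -
        have "r * (norm w * q ^ n * norm (y (Suc n))) \<le> 1 * (norm w * q ^ n * norm (y (Suc n)))"
          using r_less_1 q_pos by (intro mult_right_mono) auto
        then show ?thesis using q_le[of "norm (y (Suc n))" n] by simp
      qed
      moreover have "norm (of_real (q ^ n) * g n) \<le> B * r ^ n"
        using gB[of n] q_pos by (simp add: norm_mult norm_power)
      ultimately show ?thesis by linarith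
    qed
    have "m (Suc n) \<le> 1 + norm (x n) + B * r ^ n + (1 + norm w * r ^ n) * norm (y (Suc n))"
      unfolding m_def using x' by (simp add: algebra_simps)
    also have "\<dots> \<le> 1 + norm (x n) + B * r ^ n
        + (1 + norm w * r ^ n) * (norm (y n) + norm w * r ^ n * norm (x n))"
      using y' rn[of n] by (intro add_left_mono mult_left_mono) auto
    also have "\<dots> = m n + r ^ n * (B + norm w * norm (y n) + norm w * norm (x n)
        + (norm w)\<^sup>2 * (r ^ n * norm (x n)))"
      unfolding m_def by (simp add: algebra_simps power2_eq_square)
    also have "\<dots> \<le> m n + r ^ n * (L * m n)"
    proof (intro add_left_mono mult_left_mono)
      have "r ^ n * norm (x n) \<le> m n" 
        using mult_right_mono[OF rn(2)[of n] norm_ge_zero[of "x n"]] norm_ge_zero[of "y n"]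
        unfolding m_def by linarith
      then have "(norm w)\<^sup>2 * (r ^ n * norm (x n)) \<le> (norm w)\<^sup>2 * m n"
        by (rule mult_left_mono) simp
      moreover have "norm w * (norm (y n) + norm (x n)) \<le> norm w * m n"
        by (intro mult_left_mono) (auto simp: m_def)
      moreover have "B \<le> B * m n" using B by (simp add: m_def mult_le_cancel_left1 algebra_simps)
      ultimately show "B + norm w * norm (y n) + norm w * norm (x n)
        + (norm w)\<^sup>2 * (r ^ n * norm (x n)) \<le> L * m n"
        unfolding L_def by (simp add: algebra_simps)
    qed (use rn[of n] in auto)
    also have "\<dots> = (1 + L * r ^ n) * m n" by (simp add: algebra_simps)
    finally show ?thesis .
  qed
  have "m n \<le> m 0 * exp (\<Sum>n. L * r ^ n)" for n
    using r_pos r_less_1 L step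
    by (intro bounded_if_summable_growth summable_mult summable_geometric) (auto simp: m_def)
  moreover have "norm (y n) \<le> m n" "norm (x n) \<le> m n" for n by (simp_all add: m_def)
  ultimately have "norm (y n) \<le> m 0 * exp (\<Sum>n. L * r ^ n)" "norm (x n) \<le> m 0 * exp (\<Sum>n. L * r ^ n)" for n
    by (meson order_trans)+
  then show ?thesis unfolding x_def y_def by (rule that)
qed

text \<open>
  The Wronskian of the solution with \<open>(gsin w, gcos w)\<close> starts at \<open>- \<beta> S\<^sub>q w\<close> and its increments are the terms
  of the hypothesis, so it tends to \<open>0\<close>.  As \<open>gsin w\<close> tends to \<open>0\<close> and \<open>gcos w\<close> to \<open>1\<close>, this forces \<open>y\<close> to
  tend to \<open>0\<close>.
\<close>
lemma resolvent_tendsto_0: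
  assumes g: "(\<lambda>n. q ^ n * (norm (g n))\<^sup>2) sums \<Gamma>"
    and F: "(\<lambda>n. of_real (q ^ n) * g n * gsin w (Suc n)) sums (\<beta> * qsin q w)"
  shows "(\<lambda>n. fst (resolvent w g \<beta> n)) \<longlonglongrightarrow> 0"
proof -
  define y x where "y n = fst (resolvent w g \<beta> n)" and "x n = snd (resolvent w g \<beta> n)" for n
  note yS = resolvent_Suc(1)[of w g \<beta>, folded y_def x_def]
  note xS = resolvent_Suc(2)[of w g \<beta>, folded y_def x_def]
  obtain K where K: "\<And>n. norm (y n) \<le> K" "\<And>n. norm (x n) \<le> K"
    unfolding x_def y_def using resolvent_bounded[OF g] by blast
  define W where "W n = y n * gcos w n - x n * gsin w n" for n
  have "W (Suc n) - W n = of_real (q ^ n) * g n * gsin w (Suc n)" for n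
  proof -
    have c: "gcos w (Suc n) = gcos w n + of_real r * w * of_real (q ^ n) * gsin w (Suc n)"
      using gcos_diff[of w n] by (simp add: algebra_simps)
    have s: "gsin w n = gsin w (Suc n) + w * of_real (q ^ n) * gcos w n"
      using gsin_diff[of w n] by (simp add: algebra_simps)
    show ?thesis unfolding W_def xS s c by (simp add: yS algebra_simps)
  qed
  then have "(\<lambda>n. W (Suc n) - W n) sums (\<beta> * qsin q w)" using F by simp
  then have "(\<lambda>n. W n - W 0) \<longlonglongrightarrow> \<beta> * qsin q w"
    by (simp add: sums_def sum_lessThan_telescope)
  then have "(\<lambda>n. (W n - W 0) + W 0) \<longlonglongrightarrow> \<beta> * qsin q w + W 0"
    by (intro tendsto_intros)
  moreover have "W 0 = - (\<beta> * qsin q w)" by (simp add: W_def x_def y_def gsin_0)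
  ultimately have W: "W \<longlonglongrightarrow> 0" by simp
  have "(\<lambda>n. x n * gsin w n) \<longlonglongrightarrow> 0"
  proof (rule Lim_null_comparison)
    show "eventually (\<lambda>n. norm (x n * gsin w n) \<le> K * norm (gsin w n)) sequentially"
      using K by (auto simp: norm_mult intro!: always_eventually mult_right_mono)
    show "(\<lambda>n. K * norm (gsin w n)) \<longlonglongrightarrow> 0"
      using tendsto_mult[OF tendsto_const tendsto_norm[OF gsin_tendsto[of w]], of K] by simp
  qed
  then have "(\<lambda>n. (W n + x n * gsin w n) / gcos w n) \<longlonglongrightarrow> (0 + 0) / 1"
    by (intro tendsto_intros W gcos_tendsto) auto
  moreover have "eventually (\<lambda>n. (W n + x n * gsin w n) / gcos w n = y n) sequentially"
  proof -
    have "eventually (\<lambda>n. gcos w n \<noteq> 0) sequentially"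
      by (rule tendsto_imp_eventually_ne[OF gcos_tendsto]) simp
    then show ?thesis by eventually_elim (auto simp: W_def)
  qed
  ultimately show ?thesis unfolding y_def by (simp add: tendsto_cong)
qed

text \<open>
  The bound \<open>1 / \<bar>Im \<lambda>\<bar>\<close> for the resolvent of a self-adjoint operator at \<open>\<lambda> = w\<^sup>2\<close>.  Summation by parts of \<open>y\<close> against
  \<open>cnj x\<close> gives \<open>w p = r (cnj w) Q - T\<close> with the squared norms \<open>p\<close> and \<open>Q\<close> of \<open>x\<close> and \<open>y\<close> and the pairing \<open>T\<close> of \<open>y\<close>
  with \<open>g\<close>.  After multiplication by \<open>cnj w\<close> the imaginary part contains \<open>Q\<close> and \<open>T\<close> only, and Cauchy-Schwarz
  bounds \<open>T\<close>.
\<close>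
lemma resolvent_estimate:
  assumes g: "(\<lambda>n. q ^ n * (norm (g n))\<^sup>2) sums \<Gamma>"
    and F: "(\<lambda>n. of_real (q ^ n) * g n * gsin w (Suc n)) sums (\<beta> * qsin q w)"
  shows "(r * \<bar>Im (w\<^sup>2)\<bar>)\<^sup>2 * (q ^ n * (norm (fst (resolvent w g \<beta> (Suc n))))\<^sup>2) \<le> (norm w)\<^sup>2 * \<Gamma>"
proof -
  define y x where "y n = fst (resolvent w g \<beta> n)" and "x n = snd (resolvent w g \<beta> n)" for n
  note yS = resolvent_Suc(1)[of w g \<beta>, folded y_def x_def]
  note xS = resolvent_Suc(2)[of w g \<beta>, folded y_def x_def]
  obtain K where K: "\<And>n. norm (y n) \<le> K" "\<And>n. norm (x n) \<le> K"
    unfolding x_def y_def using resolvent_bounded[OF g] by blast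
  have y0: "y \<longlonglongrightarrow> 0" unfolding y_def[abs_def] by (rule resolvent_tendsto_0[OF g F])
  have sq_summable: "summable (\<lambda>n. q ^ n * (norm (u n))\<^sup>2)" if "\<And>n. norm (u n) \<le> K" for u :: "nat \<Rightarrow> complex"
  proof (rule summable_comparison_test'[where N = 0])
    show "summable (\<lambda>n. q ^ n * K\<^sup>2)"
      using q_pos q_less_1 by (intro summable_mult2 summable_geometric) simp
    fix n
    have "(norm (u n))\<^sup>2 \<le> K\<^sup>2" using that by (intro power_mono) auto
    then show "norm (q ^ n * (norm (u n))\<^sup>2) \<le> q ^ n * K\<^sup>2" using q_pos by simp
  qed
  define p where "p = (\<Sum>n. q ^ n * (norm (x n))\<^sup>2)"
  define Q where "Q = (\<Sum>n. q ^ n * (norm (y (Suc n)))\<^sup>2)"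
  have p: "(\<lambda>n. q ^ n * (norm (x n))\<^sup>2) sums p" and Q: "(\<lambda>n. q ^ n * (norm (y (Suc n)))\<^sup>2) sums Q"
    unfolding p_def Q_def by (intro summable_sums sq_summable K)+
  define t where "t n = of_real (q ^ n) * (y (Suc n) * cnj (g n))" for n
  have "norm (t n) = norm (of_real (q ^ n * norm (y (Suc n))) * g n)" for n
    by (simp add: t_def norm_mult)
  then have t_summable: "summable (\<lambda>n. norm (t n))" and t_le: "(\<Sum>n. norm (t n))\<^sup>2 \<le> Q * \<Gamma>"
    using weighted_Cauchy_Schwarz[OF _ Q g] q_pos by simp_all
  define T where "T = suminf t"
  have T: "t sums T" unfolding T_def by (rule summable_sums[OF summable_norm_cancel[OF t_summable]])
  have T_le: "(norm T)\<^sup>2 \<le> Q * \<Gamma>"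
    using power_mono[OF summable_norm[OF t_summable], of 2] t_le unfolding T_def by simp
  have "(\<lambda>n. (y n - y (Suc n)) * cnj (x n)) sums
          (y 0 * cnj (x 0) + (of_real r * cnj w * of_real Q - T))"
  proof (rule sums_by_parts)
    show "(\<lambda>n. y n * cnj (x n)) \<longlonglongrightarrow> 0"
    proof (rule Lim_null_comparison)
      show "eventually (\<lambda>n. norm (y n * cnj (x n)) \<le> norm (y n) * K) sequentially"
        using K by (auto simp: norm_mult intro!: always_eventually mult_left_mono)
      show "(\<lambda>n. norm (y n) * K) \<longlonglongrightarrow> 0"
        using tendsto_mult[OF tendsto_norm[OF y0] tendsto_const, of K] by simp
    qed
    have "y (Suc n) * (cnj (x (Suc n)) - cnj (x n)) =
        of_real r * cnj w * of_real (q ^ n * (norm (y (Suc n)))\<^sup>2) - t n" for n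
      unfolding xS t_def of_real_mult complex_norm_square by (simp add: algebra_simps)
    then show "(\<lambda>n. y (Suc n) * (cnj (x (Suc n)) - cnj (x n))) sums (of_real r * cnj w * of_real Q - T)"
      by (simp only:) (intro sums_diff sums_mult sums_of_real Q T)
  qed
  moreover have "(y n - y (Suc n)) * cnj (x n) = w * of_real (q ^ n * (norm (x n))\<^sup>2)" for n
    unfolding yS of_real_mult complex_norm_square by (simp add: algebra_simps)
  then have "(\<lambda>n. (y n - y (Suc n)) * cnj (x n)) sums (w * of_real p)"
    by (simp only:) (intro sums_mult sums_of_real p)
  ultimately have energy: "w * of_real p = of_real r * cnj w * of_real Q - T"
    using sums_unique2 by (metis add_0 fst_conv mult_zero_left resolvent.simps(1) y_def)
  have "w * cnj w * of_real p = of_real (r * Q) * cnj (w\<^sup>2) - cnj w * T"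
    using arg_cong[OF energy, of "\<lambda>z. cnj w * z"] by (simp add: algebra_simps power2_eq_square)
  then have "of_real ((norm w)\<^sup>2 * p) = of_real (r * Q) * cnj (w\<^sup>2) - cnj w * T"
    by (simp only: of_real_mult complex_norm_square)
  moreover have "- c * Im u = Im v" if "of_real R = of_real c * cnj u - v" for R c :: real and u v
    using that by (auto simp: complex_eq_iff)
  ultimately have "- (r * Q) * Im (w\<^sup>2) = Im (cnj w * T)" by blast
  then have "\<bar>- (r * Q) * Im (w\<^sup>2)\<bar> \<le> norm w * norm T"
    using abs_Im_le_cmod[of "cnj w * T"] by (simp only: norm_mult complex_mod_cnj)
  moreover have Q0: "Q \<ge> 0" using sums_le[OF _ sums_zero Q] q_pos by simp
  ultimately have "r * \<bar>Im (w\<^sup>2)\<bar> * Q \<le> norm w * norm T"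
    using r_pos by (simp add: abs_mult mult_ac)
  then have "(r * \<bar>Im (w\<^sup>2)\<bar> * Q)\<^sup>2 \<le> (norm w * norm T)\<^sup>2"
    using r_pos Q0 by (intro power_mono) auto
  also have "\<dots> \<le> (norm w)\<^sup>2 * (Q * \<Gamma>)"
    unfolding power_mult_distrib using T_le by (intro mult_left_mono) auto
  finally have "((r * \<bar>Im (w\<^sup>2)\<bar>)\<^sup>2 * Q) * Q \<le> ((norm w)\<^sup>2 * \<Gamma>) * Q"
    by (simp add: power_mult_distrib power2_eq_square mult_ac)
  moreover have "\<Gamma> \<ge> 0" using sums_le[OF _ sums_zero g] q_pos by simp
  ultimately have "(r * \<bar>Im (w\<^sup>2)\<bar>)\<^sup>2 * Q \<le> (norm w)\<^sup>2 * \<Gamma>"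
    using Q0 by (cases "Q = 0") (auto simp: mult_le_cancel_right)
  moreover have "q ^ n * (norm (y (Suc n)))\<^sup>2 \<le> Q"
    unfolding Q_def
    using sum_le_suminf[OF sums_summable[OF Q], of "{n}"] q_pos by auto
  then have "(r * \<bar>Im (w\<^sup>2)\<bar>)\<^sup>2 * (q ^ n * (norm (y (Suc n)))\<^sup>2) \<le> (r * \<bar>Im (w\<^sup>2)\<bar>)\<^sup>2 * Q"
    by (rule mult_left_mono) simp
  ultimately show ?thesis unfolding y_def by linarith
qed

text \<open>
  With \<open>F = G S\<^sub>q\<close> the solution started at \<open>G w\<close> decays, and its first step is \<open>- w G w\<close>; the resolvent estimate
  therefore bounds \<open>\<bar>Im (w\<^sup>2)\<bar> \<bar>G w\<bar>\<close>.  Once \<open>G = 0\<close> is known, the solution started at \<open>0\<close> first becomes nonzero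
  because of the first nonzero \<open>g n\<close>, and there it equals \<open>w\<close> times a fixed nonzero number.  The estimate at
  \<open>w = t (1 + \<i>)\<close> excludes this for large \<open>t\<close>.
\<close>
theorem sine_system_complete:
  fixes g :: "nat \<Rightarrow> complex"
  assumes g: "summable (\<lambda>n. q ^ n * (norm (g n))\<^sup>2)"
    and orth: "\<And>\<omega>::real. \<omega> > 0 \<Longrightarrow> qsin q (of_real \<omega>) = 0 \<Longrightarrow>
                 (\<Sum>n. of_real (q ^ n) * g n * gsin (of_real \<omega>) (Suc n)) = 0"
  shows "g n = 0"
proof -
  obtain \<Gamma> where \<Gamma>: "(\<lambda>n. q ^ n * (norm (g n))\<^sup>2) sums \<Gamma>" using g by blast
  have "(\<lambda>n. q ^ n * 1\<^sup>2) sums (1 / (1 - q))"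
    using geometric_sums[of q] q_pos q_less_1 by simp
  from weighted_Cauchy_Schwarz(1)[OF _ this \<Gamma>] have g1: "summable (\<lambda>n. norm (of_real (q ^ n) * g n))"
    using q_pos by simp
  define F where "F w = (\<Sum>n. of_real (q ^ n) * g n * gsin w (Suc n))" for w
  have F_hol: "F holomorphic_on UNIV"
    unfolding F_def[abs_def] gsin_def using q_pos q_power_le_1
    by (intro entire_series_dilations g1 qsin_holomorphic) (auto simp: power_le_one q_less_1 less_imp_le simp del: power_Suc)
  have F_sums: "(\<lambda>n. of_real (q ^ n) * g n * gsin w (Suc n)) sums F w" for w
  proof -
    obtain K where "\<And>n. norm (gsin w (Suc n)) \<le> K"
      using Bseq_convergent[OF gsin_Suc_tendsto[of w]] by (auto simp: Bseq_def)
    then have "norm (of_real (q ^ n) * g n * gsin w (Suc n)) \<le> norm (of_real (q ^ n) * g n) * K" for n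
      by (simp add: norm_mult mult_left_mono)
    then have "summable (\<lambda>n. of_real (q ^ n) * g n * gsin w (Suc n))"
      by (intro summable_comparison_test'[where N = 0, OF summable_mult2[OF g1]]) auto
    then show ?thesis unfolding F_def by (rule summable_sums)
  qed
  have F_odd: "F (- w) = - F w" for w
    using sums_minus[OF F_sums[of w]] sums_unique2[OF F_sums[of "- w"]] by (simp add: gsin_def qsin_odd)
  have F_vanish: "F w = 0" if w: "qsin q w = 0" for w
  proof (cases "w = 0")
    case True
    then show ?thesis using F_odd[of 0] by simp
  next
    case False
    then obtain t where t: "w = of_real t" "t \<noteq> 0"
      using qsin_zero_norms(1)[OF w] by (auto elim: Reals_cases)
    show ?thesis
    proof (cases "t > 0")
      case True
      then show ?thesis using orth[of t] w unfolding t F_def by simp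
    next
      case False
      then have "F (of_real (- t)) = 0"
        using orth[of "- t"] w t qsin_odd[of w] unfolding F_def by simp
      then show ?thesis using F_odd[of w] t by simp
    qed
  qed
  obtain G where G: "G holomorphic_on UNIV" and FG: "\<And>w. F w = G w * qsin q w"
    using entire_quotient[OF F_hol qsin_holomorphic qsin_zeros_simple F_vanish] by blast
  have estimate: "(r * \<bar>Im (w\<^sup>2)\<bar>)\<^sup>2 * (q ^ n * (norm (fst (resolvent w g (G w) (Suc n))))\<^sup>2) \<le> (norm w)\<^sup>2 * \<Gamma>"
    for w n
    using F_sums[of w] unfolding FG by (rule resolvent_estimate[OF \<Gamma>])
  have G0: "G w = 0" for w
  proof (rule entire_eq_0_if_resolvent_bound[OF G])
    fix w assume w: "Im (w\<^sup>2) \<noteq> 0"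
    then have "norm w > 0" by auto
    have f: "fst (resolvent w g (G w) (Suc 0)) = - (w * G w)" by (simp add: Let_def)
    have "(norm w)\<^sup>2 * (c * norm (G w))\<^sup>2 = c\<^sup>2 * (q ^ 0 * (norm (- (w * G w)))\<^sup>2)" for c
      unfolding norm_minus_cancel norm_mult power_mult_distrib by simp
    then have "(norm w)\<^sup>2 * (r * \<bar>Im (w\<^sup>2)\<bar> * norm (G w))\<^sup>2 \<le> (norm w)\<^sup>2 * \<Gamma>"
      using estimate[of w 0] unfolding f by (simp only:)
    then have "(r * \<bar>Im (w\<^sup>2)\<bar> * norm (G w))\<^sup>2 \<le> \<Gamma>" using \<open>norm w > 0\<close> by simp
    then have "r * \<bar>Im (w\<^sup>2)\<bar> * norm (G w) \<le> sqrt \<Gamma>" by (rule real_le_rsqrt)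
    then show "\<bar>Im (w\<^sup>2)\<bar> * norm (G w) \<le> sqrt \<Gamma> / r"
      using r_pos by (simp add: field_simps)
  qed
  show ?thesis
  proof (induction n rule: less_induct)
    case (less n)
    have zero: "resolvent w g 0 m = (0, 0)" if "m \<le> n" for w m
      using that
    proof (induction m)
      case (Suc m)
      then show ?case using less[of m] by simp
    qed simp
    have f: "fst (resolvent w g 0 (Suc (Suc n))) = w * of_real (q ^ Suc n * q ^ n) * g n" for w
      using zero[of n w] by (simp add: Let_def)
    define c where "c = 4 * r\<^sup>2 * (q ^ Suc n * (q ^ Suc n * q ^ n)\<^sup>2)"
    have c: "c > 0" using q_pos by (simp add: c_def)
    have bound: "t ^ 4 * (c * (norm (g n))\<^sup>2) \<le> \<Gamma>" if "t > 0" for t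
    proof -
      \<comment> \<open>On this ray \<open>Im (w\<^sup>2)\<close> and \<open>\<bar>w\<^sup>2\<bar>\<close> are equal.\<close>
      define w where "w = of_real t * (1 + \<i>)"
      have w2: "(norm w)\<^sup>2 > 0" using that by (simp add: w_def complex_eq_iff)
      have I: "Im (w\<^sup>2) = 2 * t\<^sup>2" by (simp add: w_def power2_eq_square)
      have "(norm w)\<^sup>2 * (t ^ 4 * (c * (norm (g n))\<^sup>2)) =
          (r * \<bar>Im (w\<^sup>2)\<bar>)\<^sup>2 * (q ^ Suc n * (norm (w * of_real (q ^ Suc n * q ^ n) * g n))\<^sup>2)"
      proof -
        have I': "\<bar>2 * t\<^sup>2\<bar> = 2 * t\<^sup>2" by simp
        have P: "\<bar>q ^ Suc n * q ^ n\<bar> = q ^ Suc n * q ^ n" using q_pos by simp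
        have "X\<^sup>2 * (t ^ 4 * ((4 * \<rho>\<^sup>2 * (Q * P\<^sup>2)) * Y\<^sup>2)) = (\<rho> * (2 * t\<^sup>2))\<^sup>2 * (Q * (X * P * Y)\<^sup>2)"
          for X Y \<rho> Q P :: real by algebra
        then show ?thesis unfolding I I' c_def norm_mult norm_of_real P .
      qed
      also have "\<dots> \<le> (norm w)\<^sup>2 * \<Gamma>"
        using estimate[of w "Suc n"] unfolding G0 f .
      finally show ?thesis using w2 by simp
    qed
    show "g n = 0"
    proof (rule ccontr)
      assume "g n \<noteq> 0"
      then have "c * (norm (g n))\<^sup>2 > 0" using c by simp
      then have "filterlim (\<lambda>t. t ^ 4 * (c * (norm (g n))\<^sup>2)) at_top at_top"
        by real_asymp
      then have "eventually (\<lambda>t. t ^ 4 * (c * (norm (g n))\<^sup>2) > \<Gamma>) at_top"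
        by (simp add: filterlim_at_top_dense)
      then have "eventually (\<lambda>t::real. False) at_top"
        using eventually_gt_at_top[of 0] by eventually_elim (use bound in force)
      then show False by simp
    qed
  qed
qed

end

section \<open>Enumeration of the zeros\<close>

text \<open>
  This is what makes the description of the \<open>k\<close>-th zero by counting meaningful.  The next element after a
  finite initial segment is the least element of the rest.
\<close>
lemma discrete_set_enumeration:
  fixes Z :: "real set"
  assumes fin: "\<And>x. finite {y \<in> Z. y \<le> x}" and inf: "infinite Z"
  shows "\<exists>!x. x \<in> Z \<and> card {y \<in> Z. y \<le> x} = Suc k"
proof (rule ex_ex1I)
  have next_element: "\<exists>x\<in>Z - A. {y \<in> Z. y \<le> x} = insert x A"
    if A: "A \<subseteq> Z" "finite A" "\<And>a z. a \<in> A \<Longrightarrow> z \<in> Z - A \<Longrightarrow> a < z" for A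
  proof -
    obtain z where z: "z \<in> Z - A"
      using inf A(2) by (metis Diff_infinite_finite ex_in_conv infinite_imp_nonempty)
    define B where "B = {y \<in> Z - A. y \<le> z}"
    have B: "finite B" "z \<in> B"
      using z unfolding B_def by (auto intro: finite_subset[OF _ fin[of z]])
    have m: "Min B \<in> B" "\<And>y. y \<in> B \<Longrightarrow> Min B \<le> y"
      using B by (auto intro: Min_in)
    have mZ: "Min B \<in> Z - A" "Min B \<le> z" using m(1) by (auto simp: B_def)
    have "y \<in> insert (Min B) A" if y: "y \<in> Z" "y \<le> Min B" for y
    proof (rule ccontr)
      assume nin: "y \<notin> insert (Min B) A"
      then have "y \<in> B" using y mZ by (auto simp: B_def)
      then show False using m(2)[of y] y nin by auto
    qed
    moreover have "a \<le> Min B" if "a \<in> A" for a using A(3)[OF that mZ(1)] by simp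
    ultimately have "{y \<in> Z. y \<le> Min B} = insert (Min B) A"
      using A(1) mZ by auto
    then show ?thesis using mZ by blast
  qed
  show "\<exists>x. x \<in> Z \<and> card {y \<in> Z. y \<le> x} = Suc k"
  proof (induction k)
    case 0
    obtain x where "x \<in> Z" "{y \<in> Z. y \<le> x} = {x}" using next_element[of "{}"] by auto
    then show ?case by (intro exI[of _ x]) simp
  next
    case (Suc k)
    then obtain x where x: "x \<in> Z" "card {y \<in> Z. y \<le> x} = Suc k" by blast
    have "\<exists>x'\<in>Z - {y \<in> Z. y \<le> x}. {y \<in> Z. y \<le> x'} = insert x' {y \<in> Z. y \<le> x}"
      by (rule next_element) (use fin in auto)
    then obtain x' where "x' \<in> Z - {y \<in> Z. y \<le> x}" "{y \<in> Z. y \<le> x'} = insert x' {y \<in> Z. y \<le> x}"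
      by blast
    then show ?case using x fin by (intro exI[of _ x']) auto
  qed
next
  have less: "card {u \<in> Z. u \<le> x} < card {u \<in> Z. u \<le> y}" if "x < y" "y \<in> Z" for x y
  proof (rule psubset_card_mono[OF fin])
    have "{u \<in> Z. u \<le> x} \<subseteq> {u \<in> Z. u \<le> y}" using that by auto
    moreover have "y \<in> {u \<in> Z. u \<le> y} - {u \<in> Z. u \<le> x}" using that by auto
    ultimately show "{u \<in> Z. u \<le> x} \<subset> {u \<in> Z. u \<le> y}" by blast
  qed
  fix x y assume x: "x \<in> Z \<and> card {u \<in> Z. u \<le> x} = Suc k" and y: "y \<in> Z \<and> card {u \<in> Z. u \<le> y} = Suc k"
  show "x = y" using less[of x y] less[of y x] x y by (cases x y rule: linorder_cases) auto
qed

context qtrig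
begin

definition positive_zeros :: "real set" where
  "positive_zeros = {x. 0 < x \<and> qsin q (of_real x) = 0}"

lemma finite_positive_zeros_below: "finite {x \<in> positive_zeros. x \<le> R}"
proof -
  have "\<not> qsin q constant_on UNIV"
  proof
    assume "qsin q constant_on UNIV"
    then obtain c where "qsin q = (\<lambda>_. c)" by (auto simp: constant_on_def)
    then show False using deriv_qsin_0 by simp
  qed
  then have "finite {z \<in> cball 0 R. qsin q z = 0}"
    by (intro holomorphic_compact_finite_zeros[OF qsin_holomorphic[of UNIV]]) auto
  then have "finite (of_real -` {z \<in> cball 0 R. qsin q z = 0} :: real set)"
    by (rule finite_vimageI) (simp add: inj_on_def)
  then show ?thesis
    by (rule rev_finite_subset) (auto simp: positive_zeros_def)
qed

lemma real_zero_norms: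
  assumes "x \<in> positive_zeros"
  shows "cos_norm2 (of_real x) = r * sin_norm2 (of_real x)" and "sin_norm2 (of_real x) > 0"
proof -
  show *: "cos_norm2 (of_real x) = r * sin_norm2 (of_real x)"
    using qsin_zero_norms(2)[of "of_real x"] assms by (auto simp: positive_zeros_def)
  then show "sin_norm2 (of_real x) > 0"
    using cos_norm2_pos[of "of_real x"] r_pos by (simp add: zero_less_mult_iff)
qed

lemma sin_pairing_zeros:
  assumes "x \<in> positive_zeros" "y \<in> positive_zeros"
  shows "sin_pairing (of_real x) (of_real y) = (if x = y then of_real (sin_norm2 (of_real x)) else 0)"
proof -
  have "(complex_of_real x)\<^sup>2 \<noteq> (of_real y)\<^sup>2" if "x \<noteq> y"
    using assms that by (simp add: positive_zeros_def power2_eq_iff flip: of_real_minus)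
  then show ?thesis
    using qsin_zeros_orthogonal(1)[of "of_real x" "of_real y"] sin_pairing_cnj[of "of_real x"] assms
    by (auto simp: positive_zeros_def)
qed

lemma cos_pairing_zeros:
  assumes "x \<in> positive_zeros" "y \<in> positive_zeros"
  shows "cos_pairing (of_real x) (of_real y) = (if x = y then of_real (cos_norm2 (of_real x)) else 0)"
proof -
  have "(complex_of_real x)\<^sup>2 \<noteq> (of_real y)\<^sup>2" if "x \<noteq> y"
    using assms that by (simp add: positive_zeros_def power2_eq_iff flip: of_real_minus)
  then show ?thesis
    using qsin_zeros_orthogonal(2)[of "of_real x" "of_real y"] cos_pairing_cnj[of "of_real x"] assms
    by (auto simp: positive_zeros_def)
qed

text \<open>
  If there were finitely many, subtracting from the unit vector at \<open>n = 0\<close> its projection to the span of the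
  sine functions would leave a sequence orthogonal to all of them, hence zero.  The unit vector would then be
  the restriction to the grid of a linear combination \<open>H\<close> of dilated \<open>S\<^sub>q\<close>.  But \<open>H\<close> is entire, and its zeros at the
  remaining grid points accumulate at \<open>0\<close>, so it would vanish identically.
\<close>
lemma infinite_positive_zeros: "infinite positive_zeros"
proof
  assume fin: "finite positive_zeros"
  define \<alpha> where "\<alpha> x = gsin (of_real x) 1 / of_real (sin_norm2 (of_real x))" for x
  define g where "g n = (if n = 0 then 1 else 0) - (\<Sum>x\<in>positive_zeros. \<alpha> x * gsin (of_real x) (Suc n))" for n
  have "g \<longlonglongrightarrow> 0 - (\<Sum>x\<in>positive_zeros. \<alpha> x * 0)"
    unfolding g_def[abs_def]
  proof (intro tendsto_intros gsin_Suc_tendsto)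
    show "(\<lambda>n. if n = 0 then 1 else 0 :: complex) \<longlonglongrightarrow> 0"
      by (rule tendsto_eventually) (auto simp: eventually_sequentially intro!: exI[of _ 1])
  qed
  then have g_lim: "g \<longlonglongrightarrow> 0" by simp
  have "summable (\<lambda>n. norm (of_real (q ^ n) * (g n * cnj (g n))))"
    using tendsto_mult[OF g_lim tendsto_cnj[OF g_lim]]
    by (intro summable_q_power_times_bounded Bseq_convergent) auto
  then have g_summable: "summable (\<lambda>n. q ^ n * (norm (g n))\<^sup>2)"
    using q_pos by (simp add: norm_mult norm_power power2_eq_square)
  have g0: "g n = 0" for n
  proof (rule sine_system_complete[OF g_summable])
    fix y :: real assume "y > 0" "qsin q (of_real y) = 0"
    then have y: "y \<in> positive_zeros" by (simp add: positive_zeros_def)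
    have 1: "(\<lambda>n. if n = 0 then gsin (of_real y) 1 else 0) sums gsin (of_real y) 1"
      using sums_If_finite_set[of "{0::nat}" "\<lambda>_. gsin (of_real y) 1"] by simp
    have 2: "(\<lambda>n. \<Sum>x\<in>positive_zeros. \<alpha> x * (of_real (q ^ n) * (gsin (of_real x) (Suc n) * gsin (of_real y) (Suc n))))
        sums (\<Sum>x\<in>positive_zeros. \<alpha> x * sin_pairing (of_real x) (of_real y))"
      by (intro sums_sum sums_mult sin_pairing_sums)
    have "(\<Sum>x\<in>positive_zeros. \<alpha> x * sin_pairing (of_real x) (of_real y))
        = (\<Sum>x\<in>positive_zeros. if x = y then gsin (of_real y) 1 else 0)"
      using real_zero_norms(2)[OF y] y by (intro sum.cong) (auto simp: sin_pairing_zeros \<alpha>_def)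
    also have "\<dots> = gsin (of_real y) 1" using fin y by simp
    finally have "(\<lambda>n. (if n = 0 then gsin (of_real y) 1 else 0) -
        (\<Sum>x\<in>positive_zeros. \<alpha> x * (of_real (q ^ n) * (gsin (of_real x) (Suc n) * gsin (of_real y) (Suc n))))) sums 0"
      using sums_diff[OF 1 2] by simp
    moreover have "(if n = 0 then gsin (of_real y) 1 else 0) -
        (\<Sum>x\<in>positive_zeros. \<alpha> x * (of_real (q ^ n) * (gsin (of_real x) (Suc n) * gsin (of_real y) (Suc n))))
        = of_real (q ^ n) * g n * gsin (of_real y) (Suc n)" for n
      unfolding g_def by (auto simp: left_diff_distrib right_diff_distrib sum_distrib_left sum_distrib_right mult_ac)
    ultimately show "(\<Sum>n. of_real (q ^ n) * g n * gsin (of_real y) (Suc n)) = 0"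
      by (simp add: sums_iff)
  qed
  define H where "H z = (\<Sum>x\<in>positive_zeros. \<alpha> x * qsin q (z * of_real x))" for z
  have H: "H holomorphic_on UNIV"
    unfolding H_def[abs_def]
    by (intro holomorphic_intros holomorphic_on_compose_gen[OF _ qsin_holomorphic[of UNIV], unfolded o_def]) auto
  have H_grid: "H (of_real (q ^ Suc n)) = (if n = 0 then 1 else 0)" for n
  proof -
    have "(if n = 0 then 1 else 0) - H (of_real (q ^ Suc n)) = 0"
      using g0[of n] unfolding g_def H_def gsin_def .
    then show ?thesis by (simp only: right_minus_eq)
  qed
  let ?U = "range (\<lambda>n. complex_of_real (q ^ Suc (Suc n)))"
  have "(\<lambda>n. complex_of_real (q ^ Suc (Suc n))) \<longlonglongrightarrow> of_real 0"
    by (intro tendsto_of_real LIMSEQ_Suc q_power_tendsto_0)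
  then have "0 islimpt ?U"
    unfolding islimpt_sequential using q_pos
    by (intro exI[of _ "\<lambda>n. complex_of_real (q ^ Suc (Suc n))"] conjI allI) auto
  moreover have "H z = 0" if z: "z \<in> ?U" for z
  proof -
    obtain n where n: "z = of_real (q ^ Suc (Suc n))" using z by blast
    show ?thesis unfolding n H_grid by simp
  qed
  ultimately have "H (of_real (q ^ Suc 0)) = 0"
    by (rule analytic_continuation[OF H open_UNIV connected_UNIV subset_UNIV UNIV_I]) simp_all
  then show False using H_grid[of 0] by simp
qed

definition zero_seq :: "nat \<Rightarrow> real" where "zero_seq k = qsin_zero q (Suc k)"

lemma zero_seq_positive_zero: "zero_seq k \<in> positive_zeros"
  and card_zero_seq: "card {y \<in> positive_zeros. y \<le> zero_seq k} = Suc k"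
proof -
  have "zero_seq k = (THE x. x \<in> positive_zeros \<and> card {y \<in> positive_zeros. y \<le> x} = Suc k)"
  proof -
    have set_eq: "{y. 0 < y \<and> y \<le> x \<and> qsin q (of_real y) = 0} = {y \<in> positive_zeros. y \<le> x}" for x
      by (auto simp: positive_zeros_def)
    have mem: "x \<in> positive_zeros \<longleftrightarrow> 0 < x \<and> qsin q (of_real x) = 0" for x
      by (simp add: positive_zeros_def)
    show ?thesis unfolding zero_seq_def qsin_zero_def set_eq by (simp only: mem conj_assoc)
  qed
  moreover note theI'[OF discrete_set_enumeration[OF finite_positive_zeros_below infinite_positive_zeros, of k]]
  ultimately show "zero_seq k \<in> positive_zeros" "card {y \<in> positive_zeros. y \<le> zero_seq k} = Suc k"
    by simp_all
qed

lemma zero_seq_inj: "zero_seq j = zero_seq k \<longleftrightarrow> j = k"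
  by (metis card_zero_seq nat.inject)

lemma zero_seq_surj:
  assumes "x \<in> positive_zeros"
  obtains k where "x = zero_seq k"
proof -
  have "card {y \<in> positive_zeros. y \<le> x} \<noteq> 0"
    using assms finite_positive_zeros_below[of x] by auto
  then obtain k where "card {y \<in> positive_zeros. y \<le> x} = Suc k" using not0_implies_Suc by blast
  then have x: "x \<in> positive_zeros \<and> card {y \<in> positive_zeros. y \<le> x} = Suc k" using assms by simp
  have k: "zero_seq k \<in> positive_zeros \<and> card {y \<in> positive_zeros. y \<le> zero_seq k} = Suc k"
    using zero_seq_positive_zero card_zero_seq by simp
  note unique = the1_equality[OF discrete_set_enumeration[OF finite_positive_zeros_below infinite_positive_zeros]]
  have "x = zero_seq k" using unique[OF x] unique[OF k] by simp
  then show ?thesis by (rule that)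
qed

lemma zero_seq_pos: "zero_seq k > 0" and qsin_zero_seq: "qsin q (of_real (zero_seq k)) = 0"
  using zero_seq_positive_zero[of k] by (simp_all add: positive_zeros_def)

abbreviation cos_mode :: "nat \<Rightarrow> nat \<Rightarrow> complex" where
  "cos_mode k n \<equiv> gcos (of_real (zero_seq k)) n"

abbreviation sin_mode :: "nat \<Rightarrow> nat \<Rightarrow> complex" where
  "sin_mode k n \<equiv> gsin (of_real (zero_seq k)) n"

abbreviation sin_mode_norm2 :: "nat \<Rightarrow> real" where
  "sin_mode_norm2 k \<equiv> sin_norm2 (of_real (zero_seq k))"

lemma cos_mode_real: "of_real (Re (cos_mode k n)) = cos_mode k n"
  unfolding gcos_def of_real_mult[symmetric] by (rule qcos_of_real)

lemma sin_mode_real: "of_real (Re (sin_mode k n)) = sin_mode k n"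
  unfolding gsin_def of_real_mult[symmetric] by (rule qsin_of_real)

lemma cos_mode_norm2: "cos_norm2 (of_real (zero_seq k)) = r * sin_mode_norm2 k"
  and sin_mode_norm2_pos: "sin_mode_norm2 k > 0"
  using real_zero_norms[OF zero_seq_positive_zero] by auto

lemma sin_mode_orthogonal:
  "(\<lambda>n. q ^ n * (Re (sin_mode j (Suc n)) * Re (sin_mode k (Suc n)))) sums (if j = k then sin_mode_norm2 k else 0)"
proof -
  have eq: "Re (of_real (q ^ n) * (sin_mode j (Suc n) * sin_mode k (Suc n))) = q ^ n * (Re (sin_mode j (Suc n)) * Re (sin_mode k (Suc n)))" for n
  proof -
    have "of_real (q ^ n) * (sin_mode j (Suc n) * sin_mode k (Suc n)) = of_real (q ^ n * (Re (sin_mode j (Suc n)) * Re (sin_mode k (Suc n))))"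
      by (simp only: of_real_mult sin_mode_real)
    then show ?thesis by (simp only: Re_complex_of_real)
  qed
  have val: "Re (sin_pairing (of_real (zero_seq j)) (of_real (zero_seq k))) = (if j = k then sin_mode_norm2 k else 0)"
    by (simp add: sin_pairing_zeros zero_seq_positive_zero zero_seq_inj cos_mode_norm2)
  from sums_Re[OF sin_pairing_sums[of "of_real (zero_seq j)" "of_real (zero_seq k)"]]
  show ?thesis by (simp only: eq val)
qed

lemma cos_mode_orthogonal:
  "(\<lambda>n. q ^ n * (Re (cos_mode j n) * Re (cos_mode k n))) sums (if j = k then r * sin_mode_norm2 k else 0)"
proof -
  have eq: "Re (of_real (q ^ n) * (cos_mode j n * cos_mode k n)) = q ^ n * (Re (cos_mode j n) * Re (cos_mode k n))" for n
  proof -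
    have "of_real (q ^ n) * (cos_mode j n * cos_mode k n) = of_real (q ^ n * (Re (cos_mode j n) * Re (cos_mode k n)))"
      by (simp only: of_real_mult cos_mode_real)
    then show ?thesis by (simp only: Re_complex_of_real)
  qed
  have val: "Re (cos_pairing (of_real (zero_seq j)) (of_real (zero_seq k))) = (if j = k then r * sin_mode_norm2 k else 0)"
    by (simp add: cos_pairing_zeros zero_seq_positive_zero zero_seq_inj cos_mode_norm2)
  from sums_Re[OF cos_pairing_sums[of "of_real (zero_seq j)" "of_real (zero_seq k)"]]
  show ?thesis by (simp only: eq val)
qed

text \<open>
  Orthogonality of the cosine functions to the constant function: the sum telescopes to \<open>S\<^sub>q\<close> at a zero.
\<close>
lemma cos_mode_mean_zero: "(\<lambda>n. of_real (q ^ n) * cos_mode k n) sums 0"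
proof -
  have "(\<lambda>n. sin_mode k n - sin_mode k (Suc n)) sums (sin_mode k 0 - 0)"
    by (rule telescope_sums'[OF gsin_tendsto])
  then have "(\<lambda>n. of_real (zero_seq k) * (of_real (q ^ n) * cos_mode k n)) sums 0"
    by (simp add: gsin_diff gsin_0 qsin_zero_seq mult_ac)
  from sums_mult_D[OF this] show ?thesis using zero_seq_pos[of k] by simp
qed

section \<open>Uniform convergence of the sine and cosine expansions\<close>

text \<open>
  Cauchy-Schwarz against the summable weight \<open>q\<^sup>n\<close>; the bound does not depend on \<open>n\<close>, and this is the source
  of the uniformity.
\<close>
lemma telescoped_bound:
  fixes E \<rho> :: "nat \<Rightarrow> complex"
  assumes E: "E \<longlonglongrightarrow> 0" "\<And>n. E n - E (Suc n) = of_real (q ^ n) * \<rho> n"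
    and \<tau>: "(\<lambda>n. q ^ n * (norm (\<rho> n))\<^sup>2) sums \<tau>"
  shows "norm (E n) \<le> sqrt (1 / (1 - q) * \<tau>)"
proof -
  have "(\<lambda>n. q ^ n * 1\<^sup>2) sums (1 / (1 - q))"
    using geometric_sums[of q] q_pos q_less_1 by simp
  note CS = weighted_Cauchy_Schwarz[OF _ this \<tau>]
  have summ: "summable (\<lambda>n. norm (of_real (q ^ n) * \<rho> n))" using CS(1) q_pos by simp
  have "(\<Sum>n. norm (of_real (q ^ n) * \<rho> n))\<^sup>2 \<le> 1 / (1 - q) * \<tau>" using CS(2) q_pos by simp
  then have S: "(\<Sum>n. norm (of_real (q ^ n) * \<rho> n)) \<le> sqrt (1 / (1 - q) * \<tau>)" by (rule real_le_rsqrt)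
  have "norm (E n - E m) \<le> sqrt (1 / (1 - q) * \<tau>)" if "n \<le> m" for m
  proof -
    have "E n - E m = (\<Sum>i=n..<m. of_real (q ^ i) * \<rho> i)"
      using sum_Suc_diff'[OF that, of "\<lambda>i. - E i"] E(2) by simp
    also have "norm \<dots> \<le> (\<Sum>i=n..<m. norm (of_real (q ^ i) * \<rho> i))" by (rule norm_sum)
    also have "\<dots> \<le> (\<Sum>n. norm (of_real (q ^ n) * \<rho> n))" by (intro sum_le_suminf summ) auto
    finally show ?thesis using S by linarith
  qed
  then have le: "\<exists>N. \<forall>m\<ge>N. norm (E n - E m) \<le> sqrt (1 / (1 - q) * \<tau>)" by blast
  have "(\<lambda>m. norm (E n - E m)) \<longlonglongrightarrow> norm (E n - 0)"
    by (intro tendsto_intros E(1))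
  from LIMSEQ_le_const2[OF this le] show ?thesis by simp
qed

lemma sums_pairing:
  fixes u v :: "nat \<Rightarrow> complex"
  assumes "u \<longlonglongrightarrow> a" "v \<longlonglongrightarrow> b"
  shows "(\<lambda>n. of_real (q ^ n) * (u n * v n)) sums (\<Sum>n. of_real (q ^ n) * (u n * v n))"
  by (rule summable_sums[OF summable_pairing[OF assms]])

text \<open>
  Here \<open>y (Suc n)\<close> is the value at \<open>q\<^sup>n\<close>, and \<open>y 0 = 0\<close> imposes the boundary condition of the sine functions.
  The quotient \<open>d\<close> of \<open>y\<close> is expanded in the constant function and the cosine functions.  Its mean is
  \<open>y 0 - lim y = 0\<close>, and summation by parts turns its cosine coefficients into the sine coefficients of \<open>y\<close>
  times the frequency.  Completeness of this system comes from that of the sine system: if \<open>z\<close> is orthogonal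
  to constants and cosines, its antiderivative \<open>Y\<close> satisfies the boundary conditions and is orthogonal to
  all sines.
\<close>
lemma sine_expansion_converges:
  fixes y :: "nat \<Rightarrow> complex"
  assumes y: "y 0 = 0" "y \<longlonglongrightarrow> 0" and l2: "summable (\<lambda>n. (norm (y n - y (Suc n)))\<^sup>2 / q ^ n)"
  defines "B k \<equiv> (\<Sum>n. of_real (q ^ n) * (y (Suc n) * sin_mode k (Suc n))) / of_real (sin_mode_norm2 k)"
  shows "\<exists>\<epsilon>. \<epsilon> \<longlonglongrightarrow> 0 \<and> (\<forall>N n. norm (y (Suc n) - (\<Sum>k<N. B k * sin_mode k (Suc n))) \<le> \<epsilon> N)"
proof -
  define d where "d n = (y n - y (Suc n)) / of_real (q ^ n)" for n
  have y_diff: "y n - y (Suc n) = of_real (q ^ n) * d n" for n using q_pos by (simp add: d_def)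
  have d_l2: "summable (\<lambda>n. q ^ n * (norm (d n))\<^sup>2)"
  proof -
    have "q ^ n * (norm (d n))\<^sup>2 = (norm (y n - y (Suc n)))\<^sup>2 / q ^ n" for n
      using q_pos by (simp add: d_def norm_divide norm_power power_divide power2_eq_square field_simps)
    then show ?thesis using l2 by simp
  qed
  define \<phi> where "\<phi> k n = (case k of 0 \<Rightarrow> 1 | Suc j \<Rightarrow> Re (cos_mode j n))" for k n
  define \<nu> where "\<nu> k = (case k of 0 \<Rightarrow> 1 / (1 - q) | Suc j \<Rightarrow> r * sin_mode_norm2 j)" for k
  define a where "a k = (case k of 0 \<Rightarrow> 0 | Suc j \<Rightarrow> of_real (zero_seq j) * B j)" for k
  have mean_zero: "(\<lambda>n. q ^ n * Re (cos_mode k n)) sums 0" for k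
    using sums_Re[OF cos_mode_mean_zero[of k]] by simp
  have by_parts: "(\<lambda>n. of_real (q ^ n) * z n * cos_mode k n) sums
      (of_real (r * zero_seq k) * (\<Sum>n. of_real (q ^ n) * (Y (Suc n) * sin_mode k (Suc n))))"
    if Y: "Y 0 = 0" "Y \<longlonglongrightarrow> 0" "\<And>n. Y n - Y (Suc n) = of_real (q ^ n) * z n" for Y z k
  proof -
    have "(\<lambda>n. (Y n - Y (Suc n)) * cos_mode k n) sums (Y 0 * cos_mode k 0 +
        of_real (r * zero_seq k) * (\<Sum>n. of_real (q ^ n) * (Y (Suc n) * sin_mode k (Suc n))))"
    proof (rule sums_by_parts)
      show "(\<lambda>n. Y n * cos_mode k n) \<longlonglongrightarrow> 0"
        using tendsto_mult[OF Y(2) gcos_tendsto] by simp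
      have "Y (Suc n) * (cos_mode k (Suc n) - cos_mode k n)
          = of_real (r * zero_seq k) * (of_real (q ^ n) * (Y (Suc n) * sin_mode k (Suc n)))" for n
      proof -
        have "cos_mode k (Suc n) - cos_mode k n = of_real r * of_real (zero_seq k) * of_real (q ^ n) * sin_mode k (Suc n)"
          by (metis gcos_diff minus_diff_eq minus_minus)
        then show ?thesis by (simp add: mult_ac)
      qed
      then show "(\<lambda>n. Y (Suc n) * (cos_mode k (Suc n) - cos_mode k n)) sums
          (of_real (r * zero_seq k) * (\<Sum>n. of_real (q ^ n) * (Y (Suc n) * sin_mode k (Suc n))))"
        by (simp only:) (intro sums_mult sums_pairing[OF LIMSEQ_Suc[OF Y(2)] gsin_Suc_tendsto])
    qed
    then show ?thesis by (simp add: Y)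
  qed
  have "\<exists>\<tau>. \<tau> \<longlonglongrightarrow> 0 \<and> (\<forall>N. (\<lambda>n. q ^ n * (norm (d n - (\<Sum>k<N. a k * of_real (\<phi> k n))))\<^sup>2) sums \<tau> N)"
  proof (rule orthogonal_expansion_converges[where p = "\<lambda>n. q ^ n" and \<phi> = \<phi> and \<nu> = \<nu>])
    show "0 < q ^ n" for n using q_pos by simp
    show "(\<lambda>n. q ^ n * (\<phi> j n * \<phi> k n)) sums (if j = k then \<nu> k else 0)" for j k
      using geometric_sums[of q] q_pos q_less_1 mean_zero cos_mode_orthogonal[of "j - 1" "k - 1"]
      by (cases j; cases k) (auto simp: \<phi>_def \<nu>_def)
    show "summable (\<lambda>n. q ^ n * (norm (d n))\<^sup>2)" by (rule d_l2)
    show "(\<lambda>n. of_real (q ^ n * \<phi> k n) * d n) sums (of_real (\<nu> k) * a k)" for k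
    proof (cases k)
      case 0
      have "(\<lambda>n. y n - y (Suc n)) sums (y 0 - 0)" by (rule telescope_sums'[OF y(2)])
      then show ?thesis using 0 y(1) by (simp add: \<phi>_def a_def y_diff)
    next
      case (Suc j)
      have "of_real (q ^ n * \<phi> k n) * d n = of_real (q ^ n) * d n * cos_mode j n" for n
        unfolding Suc \<phi>_def by (simp only: nat.case of_real_mult cos_mode_real mult_ac)
      moreover have "of_real (r * zero_seq j) * (\<Sum>n. of_real (q ^ n) * (y (Suc n) * sin_mode j (Suc n)))
          = of_real (\<nu> k) * a k"
        using sin_mode_norm2_pos[of j] by (simp add: Suc \<nu>_def a_def B_def)
      ultimately show ?thesis using by_parts[OF y y_diff, of j] by (simp only:)
    qed
    show "z n = 0" if z: "summable (\<lambda>n. q ^ n * (norm (z n))\<^sup>2)"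
      "\<And>k. (\<lambda>n. of_real (q ^ n * \<phi> k n) * z n) sums 0" for z :: "nat \<Rightarrow> complex" and n
    proof -
      have z0: "(\<lambda>n. of_real (q ^ n) * z n) sums 0" using z(2)[of 0] by (simp add: \<phi>_def)
      define Y where "Y n = - (\<Sum>i<n. of_real (q ^ i) * z i)" for n
      have "Y \<longlonglongrightarrow> - 0" unfolding Y_def[abs_def] by (intro tendsto_minus) (use z0 in \<open>simp add: sums_def\<close>)
      then have Y: "Y 0 = 0" "Y \<longlonglongrightarrow> 0" "\<And>n. Y n - Y (Suc n) = of_real (q ^ n) * z n"
        by (simp_all add: Y_def)
      have Y_orth: "(\<Sum>n. of_real (q ^ n) * (Y (Suc n) * sin_mode k (Suc n))) = 0" for k
      proof -
        have "of_real (q ^ n * \<phi> (Suc k) n) * z n = of_real (q ^ n) * z n * cos_mode k n" for n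
          unfolding \<phi>_def by (simp only: nat.case of_real_mult cos_mode_real mult_ac)
        then have "(\<lambda>n. of_real (q ^ n) * z n * cos_mode k n) sums 0" using z(2)[of "Suc k"] by (simp only:)
        from sums_unique2[OF this by_parts[OF Y]] show ?thesis
          using zero_seq_pos[of k] q_pos by simp
      qed
      have "summable (\<lambda>n. norm (of_real (q ^ n) * (Y (Suc n) * cnj (Y (Suc n)))))"
        using tendsto_mult[OF LIMSEQ_Suc[OF Y(2)] tendsto_cnj[OF LIMSEQ_Suc[OF Y(2)]]]
        by (intro summable_q_power_times_bounded Bseq_convergent) auto
      then have Y_l2: "summable (\<lambda>n. q ^ n * (norm (Y (Suc n)))\<^sup>2)"
        using q_pos by (simp add: norm_mult norm_power power2_eq_square)
      have "Y (Suc n) = 0" for n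
      proof (rule sine_system_complete[where g = "\<lambda>n. Y (Suc n)", OF Y_l2])
        fix x :: real assume "x > 0" "qsin q (of_real x) = 0"
        then have "x \<in> positive_zeros" by (simp add: positive_zeros_def)
        then obtain k where "x = zero_seq k" by (rule zero_seq_surj)
        then show "(\<Sum>n. of_real (q ^ n) * Y (Suc n) * gsin (of_real x) (Suc n)) = 0"
          using Y_orth[of k] by (simp add: mult.assoc)
      qed
      then have "Y n = 0" for n using Y(1) by (cases n) auto
      then show "z n = 0" using Y(3)[of n] q_pos by simp
    qed
  qed
  then obtain \<tau> where \<tau>: "\<tau> \<longlonglongrightarrow> 0"
    "\<And>N. (\<lambda>n. q ^ n * (norm (d n - (\<Sum>k<N. a k * of_real (\<phi> k n))))\<^sup>2) sums \<tau> N" by blast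
  \<comment> \<open>The index of \<open>\<tau>\<close> is shifted because the constant function precedes the \<open>N\<close> cosine functions.\<close>
  have "norm (y n - (\<Sum>k<N. B k * sin_mode k n)) \<le> sqrt (1 / (1 - q) * \<tau> (Suc N))" for N n
  proof (rule telescoped_bound[where E = "\<lambda>n. y n - (\<Sum>k<N. B k * sin_mode k n)", OF _ _ \<tau>(2)])
    have "(\<lambda>n. y n - (\<Sum>k<N. B k * sin_mode k n)) \<longlonglongrightarrow> 0 - (\<Sum>k<N. B k * 0)"
      by (intro tendsto_intros y gsin_tendsto)
    then show "(\<lambda>n. y n - (\<Sum>k<N. B k * sin_mode k n)) \<longlonglongrightarrow> 0" by simp
    fix n
    have "(\<Sum>k<N. B k * sin_mode k n) - (\<Sum>k<N. B k * sin_mode k (Suc n)) = (\<Sum>k<N. B k * (sin_mode k n - sin_mode k (Suc n)))"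
      by (simp add: sum_subtractf right_diff_distrib)
    also have "\<dots> = of_real (q ^ n) * (\<Sum>k<N. a (Suc k) * of_real (\<phi> (Suc k) n))"
      unfolding gsin_diff a_def \<phi>_def by (simp add: cos_mode_real sum_distrib_left mult_ac)
    also have "(\<Sum>k<N. a (Suc k) * of_real (\<phi> (Suc k) n)) = (\<Sum>k<Suc N. a k * of_real (\<phi> k n))"
      unfolding sum.lessThan_Suc_shift by (simp add: a_def)
    finally show "y n - (\<Sum>k<N. B k * sin_mode k n) - (y (Suc n) - (\<Sum>k<N. B k * sin_mode k (Suc n)))
        = of_real (q ^ n) * (d n - (\<Sum>k<Suc N. a k * of_real (\<phi> k n)))"
      unfolding right_diff_distrib y_diff[symmetric] by (simp add: algebra_simps)
  qed
  moreover have "(\<lambda>N. sqrt (1 / (1 - q) * \<tau> (Suc N))) \<longlonglongrightarrow> sqrt (1 / (1 - q) * 0)"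
    by (intro tendsto_intros LIMSEQ_Suc[OF \<tau>(1)])
  ultimately show ?thesis by (intro exI[of _ "\<lambda>N. sqrt (1 / (1 - q) * \<tau> (Suc N))"]) auto
qed

text \<open>
  The quotient \<open>d\<close> of \<open>e\<close> is expanded in the sine functions.  Summing up from \<open>n\<close> to infinity recovers
  \<open>e - l\<close> and the functions \<open>cos_mode k - 1\<close>, because \<open>l\<close> and \<open>1\<close> are the limits at the accumulation point.  The
  remaining constant is determined by taking means: cosines have mean zero, so the error of the sum of the
  coefficients \<open>A k\<close>, as an approximation of \<open>l - m\<close>, is the mean of the errors already bounded.
\<close>
lemma cosine_expansion_converges:
  fixes e :: "nat \<Rightarrow> complex"
  assumes e: "e \<longlonglongrightarrow> l" and l2: "summable (\<lambda>n. (norm (e n - e (Suc n)))\<^sup>2 / q ^ n)"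
  defines "m \<equiv> of_real (1 - q) * (\<Sum>n. of_real (q ^ n) * e n)"
  defines "A k \<equiv> (\<Sum>n. of_real (q ^ n) * (e n * cos_mode k n)) / of_real (r * sin_mode_norm2 k)"
  shows "\<exists>\<epsilon>. \<epsilon> \<longlonglongrightarrow> 0 \<and> (\<forall>N n. norm (e n - (m + (\<Sum>k<N. A k * cos_mode k n))) \<le> \<epsilon> N)"
proof -
  define d where "d n = (e n - e (Suc n)) / of_real (q ^ n)" for n
  have e_diff: "e n - e (Suc n) = of_real (q ^ n) * d n" for n using q_pos by (simp add: d_def)
  have d_l2: "summable (\<lambda>n. q ^ n * (norm (d n))\<^sup>2)"
  proof -
    have "q ^ n * (norm (d n))\<^sup>2 = (norm (e n - e (Suc n)))\<^sup>2 / q ^ n" for n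
      using q_pos by (simp add: d_def norm_divide norm_power power_divide power2_eq_square field_simps)
    then show ?thesis using l2 by simp
  qed
  define a where "a k = - of_real (r * zero_seq k) * A k" for k
  have "\<exists>\<tau>. \<tau> \<longlonglongrightarrow> 0 \<and> (\<forall>N. (\<lambda>n. q ^ n * (norm (d n - (\<Sum>k<N. a k * of_real (Re (sin_mode k (Suc n))))))\<^sup>2) sums \<tau> N)"
  proof (rule orthogonal_expansion_converges[where p = "\<lambda>n. q ^ n" and \<nu> = sin_mode_norm2 and \<phi> = "\<lambda>k n. Re (sin_mode k (Suc n))"])
    show "0 < q ^ n" for n using q_pos by simp
    show "(\<lambda>n. q ^ n * (Re (sin_mode j (Suc n)) * Re (sin_mode k (Suc n)))) sums (if j = k then sin_mode_norm2 k else 0)" for j k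
      by (rule sin_mode_orthogonal)
    show "summable (\<lambda>n. q ^ n * (norm (d n))\<^sup>2)" by (rule d_l2)
    show "z n = 0" if z: "summable (\<lambda>n. q ^ n * (norm (z n))\<^sup>2)"
      "\<And>k. (\<lambda>n. of_real (q ^ n * Re (sin_mode k (Suc n))) * z n) sums 0" for z :: "nat \<Rightarrow> complex" and n
    proof (rule sine_system_complete[OF z(1)])
      fix x :: real assume "x > 0" "qsin q (of_real x) = 0"
      then have "x \<in> positive_zeros" by (simp add: positive_zeros_def)
      then obtain k where k: "x = zero_seq k" by (rule zero_seq_surj)
      have "of_real (q ^ n * Re (sin_mode k (Suc n))) * z n = of_real (q ^ n) * z n * sin_mode k (Suc n)" for n
        by (simp only: of_real_mult sin_mode_real mult_ac)
      then have "(\<lambda>n. of_real (q ^ n) * z n * sin_mode k (Suc n)) sums 0"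
        using z(2)[of k] by (simp only:)
      then show "(\<Sum>n. of_real (q ^ n) * z n * gsin (of_real x) (Suc n)) = 0"
        unfolding k by (rule sums_unique[symmetric])
    qed
    fix k
    let ?s = "\<lambda>n. of_real (q ^ n * Re (sin_mode k (Suc n))) * d n"
    have s_eq: "sin_mode k (Suc n) * (e (Suc n) - e n) = - ?s n" for n
    proof -
      have "e (Suc n) - e n = - (of_real (q ^ n) * d n)" using e_diff[of n] by (simp add: algebra_simps)
      then show ?thesis unfolding of_real_mult sin_mode_real by simp
    qed
    have "(\<lambda>n. q ^ n * (Re (sin_mode k (Suc n)))\<^sup>2) sums sin_mode_norm2 k"
      using sin_mode_orthogonal[of k k] by (simp add: power2_eq_square)
    from weighted_Cauchy_Schwarz(1)[OF _ this summable_sums[OF d_l2]]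
    have "summable (\<lambda>n. norm (?s n))" using q_pos by simp
    then have "?s sums suminf ?s" by (rule summable_sums[OF summable_norm_cancel])
    then obtain t where t: "?s sums t" ..
    have "(\<lambda>n. (sin_mode k n - sin_mode k (Suc n)) * e n) sums (sin_mode k 0 * e 0 + (- t))"
    proof (rule sums_by_parts)
      show "(\<lambda>n. sin_mode k n * e n) \<longlonglongrightarrow> 0" using tendsto_mult[OF gsin_tendsto e] by simp
      show "(\<lambda>n. sin_mode k (Suc n) * (e (Suc n) - e n)) sums (- t)"
        unfolding s_eq by (rule sums_minus[OF t])
    qed
    then have "(\<lambda>n. of_real (zero_seq k) * (of_real (q ^ n) * (e n * cos_mode k n))) sums (- t)"
      by (simp add: gsin_diff gsin_0 qsin_zero_seq mult_ac)
    moreover have "(\<lambda>n. of_real (zero_seq k) * (of_real (q ^ n) * (e n * cos_mode k n))) sums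
        (of_real (zero_seq k) * (\<Sum>n. of_real (q ^ n) * (e n * cos_mode k n)))"
      by (intro sums_mult sums_pairing[OF e gcos_tendsto])
    ultimately have "- t = of_real (zero_seq k) * (\<Sum>n. of_real (q ^ n) * (e n * cos_mode k n))"
      by (rule sums_unique2)
    then have "t = - (of_real (zero_seq k) * (\<Sum>n. of_real (q ^ n) * (e n * cos_mode k n)))"
      by (metis minus_minus)
    then have "t = of_real (sin_mode_norm2 k) * a k"
      using sin_mode_norm2_pos[of k] q_pos by (simp add: a_def A_def)
    then show "?s sums (of_real (sin_mode_norm2 k) * a k)" using t by simp
  qed
  then obtain \<tau> where \<tau>: "\<tau> \<longlonglongrightarrow> 0"
    "\<And>N. (\<lambda>n. q ^ n * (norm (d n - (\<Sum>k<N. a k * of_real (Re (sin_mode k (Suc n))))))\<^sup>2) sums \<tau> N" by blast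
  define \<epsilon> where "\<epsilon> N = sqrt (1 / (1 - q) * \<tau> N)" for N
  define E where "E N n = e n - l - (\<Sum>k<N. A k * (cos_mode k n - 1))" for N n
  have E_lim: "E N \<longlonglongrightarrow> 0" for N
  proof -
    have "E N \<longlonglongrightarrow> l - l - (\<Sum>k<N. A k * (1 - 1))"
      unfolding E_def[abs_def] by (intro tendsto_intros e gcos_tendsto)
    then show ?thesis by simp
  qed
  have E_le: "norm (E N n) \<le> \<epsilon> N" for N n
    unfolding \<epsilon>_def
  proof (rule telescoped_bound[OF E_lim _ \<tau>(2)])
    fix n
    have "(\<Sum>k<N. A k * (cos_mode k n - 1)) - (\<Sum>k<N. A k * (cos_mode k (Suc n) - 1))
        = (\<Sum>k<N. A k * (cos_mode k n - cos_mode k (Suc n)))"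
      by (simp add: algebra_simps flip: sum_subtractf)
    also have "\<dots> = of_real (q ^ n) * (\<Sum>k<N. a k * of_real (Re (sin_mode k (Suc n))))"
      unfolding gcos_diff a_def sin_mode_real by (simp add: sum_distrib_left mult_ac)
    finally show "E N n - E N (Suc n) = of_real (q ^ n) * (d n - (\<Sum>k<N. a k * of_real (Re (sin_mode k (Suc n)))))"
      unfolding E_def right_diff_distrib e_diff[symmetric] by (simp add: algebra_simps)
  qed
  have q_sums: "(\<lambda>n. complex_of_real (q ^ n)) sums of_real (1 / (1 - q))"
    using geometric_sums[of q] q_pos q_less_1 by (intro sums_of_real) simp
  have mean_E: "norm (m - l + (\<Sum>k<N. A k)) \<le> \<epsilon> N" for N
  proof -
    have e_sums: "(\<lambda>n. of_real (q ^ n) * e n) sums (\<Sum>n. of_real (q ^ n) * e n)"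
      using sums_pairing[OF e tendsto_const[of 1]] by simp
    have "(\<lambda>n. of_real (q ^ n) * e n - of_real (q ^ n) * l
        - (\<Sum>k<N. A k * (of_real (q ^ n) * cos_mode k n - of_real (q ^ n)))) sums
        ((\<Sum>n. of_real (q ^ n) * e n) - of_real (1 / (1 - q)) * l - (\<Sum>k<N. A k * (0 - of_real (1 / (1 - q)))))"
      by (intro sums_diff sums_sum sums_mult sums_mult2 e_sums q_sums cos_mode_mean_zero)
    moreover have "of_real (q ^ n) * e n - of_real (q ^ n) * l
        - (\<Sum>k<N. A k * (of_real (q ^ n) * cos_mode k n - of_real (q ^ n))) = of_real (q ^ n) * E N n" for n
      unfolding E_def by (simp add: algebra_simps sum_distrib_left)
    moreover have "(\<Sum>n. of_real (q ^ n) * e n) - of_real (1 / (1 - q)) * l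
        - (\<Sum>k<N. A k * (0 - of_real (1 / (1 - q)))) = (m - l + (\<Sum>k<N. A k)) / of_real (1 - q)"
    proof -
      define c where "c = complex_of_real (1 - q)"
      have c: "c \<noteq> 0" and inv: "complex_of_real (1 / (1 - q)) = 1 / c"
        using q_less_1 by (simp_all add: c_def)
      have "(\<Sum>k<N. A k * (0 - 1 / c)) = - ((\<Sum>k<N. A k) / c)"
        by (simp add: sum_negf sum_divide_distrib)
      then show ?thesis
        unfolding inv m_def c_def[symmetric] using c by (simp add: field_simps)
    qed
    ultimately have *: "(\<lambda>n. of_real (q ^ n) * E N n) sums ((m - l + (\<Sum>k<N. A k)) / of_real (1 - q))"
      by simp
    have "norm (\<Sum>n. of_real (q ^ n) * E N n) \<le> (\<Sum>n. q ^ n * \<epsilon> N)"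
      using E_le q_pos q_less_1
      by (intro norm_suminf_le summable_mult2 summable_geometric) (auto simp: norm_mult norm_power)
    also have "\<dots> = 1 / (1 - q) * \<epsilon> N"
      using q_pos q_less_1 by (intro sums_unique[symmetric] sums_mult2 geometric_sums) simp
    finally have "norm (m - l + (\<Sum>k<N. A k)) / (1 - q) \<le> 1 / (1 - q) * \<epsilon> N"
      unfolding sums_unique[OF *, symmetric] norm_divide norm_of_real using q_less_1 by simp
    then show ?thesis using q_less_1 by (simp add: divide_le_cancel)
  qed
  have "norm (e n - (m + (\<Sum>k<N. A k * cos_mode k n))) \<le> 2 * \<epsilon> N" for N n
  proof -
    have eq: "e n - (m + (\<Sum>k<N. A k * cos_mode k n)) = E N n - (m - l + (\<Sum>k<N. A k))"
      by (simp add: E_def right_diff_distrib sum_subtractf)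
    show ?thesis
      unfolding eq
      using norm_triangle_ineq4[of "E N n" "m - l + (\<Sum>k<N. A k)"] E_le[of N n] mean_E[of N]
      by linarith
  qed
  moreover have "(\<lambda>N. 2 * \<epsilon> N) \<longlonglongrightarrow> 2 * sqrt (1 / (1 - q) * 0)"
    unfolding \<epsilon>_def[abs_def] by (intro tendsto_intros \<tau>(1))
  ultimately show ?thesis by (intro exI[of _ "\<lambda>N. 2 * \<epsilon> N"]) auto
qed

end

section \<open>Fourier coefficients and the convergence theorem\<close>

context qtrig
begin

text \<open>
  With \<open>Q = q\<^sup>\<lambda>\<close> the condition \<open>Q\<^sup>2 < q\<close> is \<open>\<lambda> > 1/2\<close>.
\<close>
lemma summable_of_geometric_decay:
  fixes h :: "nat \<Rightarrow> complex"
  assumes h: "\<And>n. norm (h n) \<le> M * Q ^ n" and Q: "Q\<^sup>2 < q"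
  shows "summable (\<lambda>n. (norm (h n))\<^sup>2 / q ^ n)"
proof (rule summable_comparison_test'[where N = 0])
  show "summable (\<lambda>n. M\<^sup>2 * (Q\<^sup>2 / q) ^ n)"
    using Q q_pos by (intro summable_mult summable_geometric) simp
  fix n
  have "(norm (h n))\<^sup>2 \<le> (M * Q ^ n)\<^sup>2" using h[of n] by (intro power_mono) auto
  then have "(norm (h n))\<^sup>2 / q ^ n \<le> (M * Q ^ n)\<^sup>2 / q ^ n"
    using q_pos by (intro divide_right_mono) auto
  also have "\<dots> = M\<^sup>2 * (Q\<^sup>2 / q) ^ n"
    by (simp add: power_mult_distrib power_divide mult.commute flip: power_mult)
  finally show "norm ((norm (h n))\<^sup>2 / q ^ n) \<le> M\<^sup>2 * (Q\<^sup>2 / q) ^ n" using q_pos by simp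
qed

lemma qint_symmetric:
  assumes "(\<lambda>n. of_real (q ^ n) * h (q ^ n)) sums U" "(\<lambda>n. of_real (q ^ n) * h (- (q ^ n))) sums V"
  shows "qint q (-1) 1 h = of_real (1 - q) * (U + V)"
proof -
  have "(\<Sum>n. h (1 * q ^ n) * of_real (q ^ n)) = U" "(\<Sum>n. h (- 1 * q ^ n) * of_real (q ^ n)) = V"
    using assms by (simp_all add: sums_iff mult.commute)
  then show ?thesis unfolding qint_def qint0_def by (simp add: algebra_simps)
qed

lemma qcos_grid:
  "qcos q (of_real (q powr (1/2) * qsin_zero q (Suc k) * q ^ n)) = cos_mode k n"
  "qcos q (of_real (q powr (1/2) * qsin_zero q (Suc k) * - (q ^ n))) = cos_mode k n"
proof -
  have "of_real (q powr (1/2) * qsin_zero q (Suc k) * q ^ n) = complex_of_real (r * q ^ n) * of_real (zero_seq k)"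
    using q_pos by (simp add: zero_seq_def powr_half_sqrt)
  then show 1: "qcos q (of_real (q powr (1/2) * qsin_zero q (Suc k) * q ^ n)) = cos_mode k n"
    by (simp only: gcos_def)
  show "qcos q (of_real (q powr (1/2) * qsin_zero q (Suc k) * - (q ^ n))) = cos_mode k n"
    unfolding mult_minus_right of_real_minus qcos_even by (rule 1)
qed

lemma qsin_grid:
  "qsin q (of_real (q * qsin_zero q (Suc k) * q ^ n)) = sin_mode k (Suc n)"
  "qsin q (of_real (q * qsin_zero q (Suc k) * - (q ^ n))) = - sin_mode k (Suc n)"
proof -
  have "of_real (q * qsin_zero q (Suc k) * q ^ n) = complex_of_real (q ^ Suc n) * of_real (zero_seq k)"
    by (simp add: zero_seq_def)
  then show 1: "qsin q (of_real (q * qsin_zero q (Suc k) * q ^ n)) = sin_mode k (Suc n)"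
    by (simp only: gsin_def)
  show "qsin q (of_real (q * qsin_zero q (Suc k) * - (q ^ n))) = - sin_mode k (Suc n)"
    unfolding mult_minus_right of_real_minus qsin_odd 1 by (rule refl)
qed

lemma qmu_Suc: "qmu q (Suc k) = of_real (1 - q) * (2 * of_real (r * sin_mode_norm2 k))"
proof -
  have "deriv (qsin q) (of_real (zero_seq k)) * qcos q (of_real r * of_real (zero_seq k))
      = 2 * of_real (r * sin_mode_norm2 k)"
    using deriv_qsin_at_zero[OF qsin_zero_seq, of k] zero_seq_pos[of k] unfolding cos_mode_norm2 by simp
  then show ?thesis
    using q_pos by (simp add: qmu_def zero_seq_def powr_half_sqrt mult_ac)
qed

text \<open>
  By parity only the even part \<open>e\<close> of \<open>f\<close> contributes to the cosine coefficients and only the odd part \<open>d\<close> to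
  the sine coefficients; the factor \<open>2 (1 - q)\<close> common to the integral over \<open>[-1, 1]\<close> and to \<open>\<mu>\<^sub>k\<close> cancels.
\<close>
lemma qfourier_coefficients:
  fixes f :: "real \<Rightarrow> complex"
  assumes lim: "(\<lambda>n. f (q ^ n)) \<longlonglongrightarrow> l" "(\<lambda>n. f (- (q ^ n))) \<longlonglongrightarrow> l"
  defines "e n \<equiv> (f (q ^ n) + f (- (q ^ n))) / 2" and "d n \<equiv> (f (q ^ n) - f (- (q ^ n))) / 2"
  shows "qfourier_a0 q f / 2 = of_real (1 - q) * (\<Sum>n. of_real (q ^ n) * e n)"
    and "qfourier_a q f (Suc k) = (\<Sum>n. of_real (q ^ n) * (e n * cos_mode k n)) / of_real (r * sin_mode_norm2 k)"
    and "qfourier_b q f (Suc k) = (\<Sum>n. of_real (q ^ n) * (d n * sin_mode k (Suc n))) / of_real (sin_mode_norm2 k)"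
proof -
  let ?u = "\<lambda>n. f (q ^ n)" and ?v = "\<lambda>n. f (- (q ^ n))"
  have e_sums: "(\<lambda>n. of_real (q ^ n) * (e n * z n)) sums ((U + V) / 2)"
    if "(\<lambda>n. of_real (q ^ n) * (?u n * z n)) sums U" "(\<lambda>n. of_real (q ^ n) * (?v n * z n)) sums V"
    for z :: "nat \<Rightarrow> complex" and U V
    using sums_divide[OF sums_add[OF that], of 2]
    by (simp add: e_def add_divide_distrib distrib_left distrib_right)
  have d_sums: "(\<lambda>n. of_real (q ^ n) * (d n * z n)) sums ((U - V) / 2)"
    if "(\<lambda>n. of_real (q ^ n) * (?u n * z n)) sums U" "(\<lambda>n. of_real (q ^ n) * (?v n * z n)) sums V"
    for z :: "nat \<Rightarrow> complex" and U V
    using sums_divide[OF sums_diff[OF that], of 2]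
    by (simp add: d_def diff_divide_distrib left_diff_distrib right_diff_distrib)
  have ne: "of_real (1 - q) \<noteq> (0 :: complex)" "of_real (sin_mode_norm2 k) \<noteq> (0 :: complex)"
    "of_real (q powr (1/2)) = complex_of_real r" "complex_of_real r \<noteq> 0"
    using q_less_1 sin_mode_norm2_pos[of k] q_pos by (auto simp: powr_half_sqrt)

  note 1 = sums_pairing[OF lim(1) tendsto_const[of 1]] and 2 = sums_pairing[OF lim(2) tendsto_const[of 1]]
  have "qfourier_a0 q f = of_real (1 - q) *
      ((\<Sum>n. of_real (q ^ n) * (?u n * 1)) + (\<Sum>n. of_real (q ^ n) * (?v n * 1)))"
    unfolding qfourier_a0_def by (rule qint_symmetric) (use 1 2 in simp_all)
  then show "qfourier_a0 q f / 2 = of_real (1 - q) * (\<Sum>n. of_real (q ^ n) * e n)"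
    using sums_unique[OF e_sums[OF 1 2]] by simp

  note 1 = sums_pairing[OF lim(1) gcos_tendsto[of "of_real (zero_seq k)"]]
    and 2 = sums_pairing[OF lim(2) gcos_tendsto[of "of_real (zero_seq k)"]]
  have "qint q (-1) 1 (\<lambda>t. f t * qcos q (of_real (q powr (1/2) * qsin_zero q (Suc k) * t))) = of_real (1 - q) *
      ((\<Sum>n. of_real (q ^ n) * (?u n * cos_mode k n)) + (\<Sum>n. of_real (q ^ n) * (?v n * cos_mode k n)))"
    by (rule qint_symmetric) (unfold qcos_grid, (rule 1 2)+)
  also have "\<dots> = of_real (1 - q) * (2 * (\<Sum>n. of_real (q ^ n) * (e n * cos_mode k n)))"
    using sums_unique[OF e_sums[OF 1 2]] by simp
  finally show "qfourier_a q f (Suc k) = (\<Sum>n. of_real (q ^ n) * (e n * cos_mode k n)) / of_real (r * sin_mode_norm2 k)"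
    unfolding qfourier_a_def qmu_Suc using ne by (simp only: of_real_mult) (simp add: field_simps)

  note 1 = sums_pairing[OF lim(1) gsin_Suc_tendsto[of "of_real (zero_seq k)"]]
    and 2 = sums_pairing[OF lim(2) gsin_Suc_tendsto[of "of_real (zero_seq k)"]]
  have "qint q (-1) 1 (\<lambda>t. f t * qsin q (of_real (q * qsin_zero q (Suc k) * t))) = of_real (1 - q) *
      ((\<Sum>n. of_real (q ^ n) * (?u n * sin_mode k (Suc n))) + - (\<Sum>n. of_real (q ^ n) * (?v n * sin_mode k (Suc n))))"
  proof (rule qint_symmetric)
    show "(\<lambda>n. of_real (q ^ n) * (?u n * qsin q (of_real (q * qsin_zero q (Suc k) * q ^ n)))) sums
        (\<Sum>n. of_real (q ^ n) * (?u n * sin_mode k (Suc n)))"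
      unfolding qsin_grid by (rule 1)
    show "(\<lambda>n. of_real (q ^ n) * (?v n * qsin q (of_real (q * qsin_zero q (Suc k) * - (q ^ n))))) sums
        (- (\<Sum>n. of_real (q ^ n) * (?v n * sin_mode k (Suc n))))"
      unfolding qsin_grid using sums_minus[OF 2] by (simp only: mult_minus_right)
  qed
  also have "\<dots> = of_real (1 - q) * (2 * (\<Sum>n. of_real (q ^ n) * (d n * sin_mode k (Suc n))))"
    using sums_unique[OF d_sums[OF 1 2]] by simp
  finally show "qfourier_b q f (Suc k) = (\<Sum>n. of_real (q ^ n) * (d n * sin_mode k (Suc n))) / of_real (sin_mode_norm2 k)"
    unfolding qfourier_b_def qmu_Suc ne(3) using ne by (simp only: of_real_mult) (simp add: field_simps)
qed

theorem qfourier_converges_uniformly: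
  fixes f :: "real \<Rightarrow> complex"
  assumes lim: "(\<lambda>n. f (q ^ n)) \<longlonglongrightarrow> l" "(\<lambda>n. f (- (q ^ n))) \<longlonglongrightarrow> l"
    and decay: "\<And>n. norm (f (q ^ n) - f (q ^ Suc n)) \<le> M * Q ^ n"
      "\<And>n. norm (f (- (q ^ n)) - f (- (q ^ Suc n))) \<le> M * Q ^ n"
    and Q: "Q\<^sup>2 < q"
  shows "uniform_limit (qV q) (qfourier_partial_sum q f) f sequentially"
proof -
  define e where "e n = (f (q ^ n) + f (- (q ^ n))) / 2" for n
  define d where "d n = (f (q ^ n) - f (- (q ^ n))) / 2" for n
  \<comment> \<open>The odd part, moved by one index so that the value \<open>0\<close> can be put at the grid point \<open>1/q\<close>.\<close>
  define y where "y n = (case n of 0 \<Rightarrow> 0 | Suc m \<Rightarrow> d m)" for n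
  note coeffs = qfourier_coefficients[OF lim, folded e_def d_def]
  have "e \<longlonglongrightarrow> (l + l) / 2" "d \<longlonglongrightarrow> (l - l) / 2"
    unfolding e_def[abs_def] d_def[abs_def] by (intro tendsto_intros lim; simp)+
  then have e_lim: "e \<longlonglongrightarrow> l" and d_lim: "d \<longlonglongrightarrow> 0" by simp_all
  have e_decay: "norm (e n - e (Suc n)) \<le> M * Q ^ n" and d_decay: "norm (d n - d (Suc n)) \<le> M * Q ^ n" for n
  proof -
    define a b where "a = f (q ^ n) - f (q ^ Suc n)" and "b = f (- (q ^ n)) - f (- (q ^ Suc n))"
    have eq: "e n - e (Suc n) = (a + b) / 2" "d n - d (Suc n) = (a - b) / 2"
      by (simp_all add: e_def d_def a_def b_def field_simps)
    have "norm (e n - e (Suc n)) = norm (a + b) / 2" "norm (d n - d (Suc n)) = norm (a - b) / 2"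
      unfolding eq by (simp_all add: norm_divide)
    moreover have "norm a \<le> M * Q ^ n" "norm b \<le> M * Q ^ n"
      unfolding a_def b_def by (rule decay)+
    ultimately show "norm (e n - e (Suc n)) \<le> M * Q ^ n" "norm (d n - d (Suc n)) \<le> M * Q ^ n"
      using norm_triangle_ineq[of a b] norm_triangle_ineq4[of a b] by linarith+
  qed
  have y: "y 0 = 0" "\<And>n. y (Suc n) = d n" by (simp_all add: y_def)
  have y_lim: "y \<longlonglongrightarrow> 0" by (rule LIMSEQ_imp_Suc) (simp add: y d_lim)
  have y_l2: "summable (\<lambda>n. (norm (y n - y (Suc n)))\<^sup>2 / q ^ n)"
  proof -
    have "summable (\<lambda>n. (norm (d n - d (Suc n)))\<^sup>2 / q ^ n / q)"
      by (intro summable_divide summable_of_geometric_decay[OF d_decay Q])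
    then have "summable (\<lambda>n. (norm (y (Suc n) - y (Suc (Suc n))))\<^sup>2 / q ^ Suc n)"
      by (simp add: y mult.commute)
    then show ?thesis by (subst (asm) summable_Suc_iff)
  qed
  obtain \<epsilon>1 where \<epsilon>1: "\<epsilon>1 \<longlonglongrightarrow> 0"
    "\<And>N n. norm (d n - (\<Sum>k<N. qfourier_b q f (Suc k) * sin_mode k (Suc n))) \<le> \<epsilon>1 N"
    using sine_expansion_converges[OF y(1) y_lim y_l2] unfolding coeffs y by blast
  obtain \<epsilon>2 where \<epsilon>2: "\<epsilon>2 \<longlonglongrightarrow> 0"
    "\<And>N n. norm (e n - (qfourier_a0 q f / 2 + (\<Sum>k<N. qfourier_a q f (Suc k) * cos_mode k n))) \<le> \<epsilon>2 N"
    using cosine_expansion_converges[OF e_lim summable_of_geometric_decay[OF e_decay Q]]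
    unfolding coeffs by blast
  have bound: "dist (qfourier_partial_sum q f N x) (f x) \<le> \<epsilon>1 N + \<epsilon>2 N" if "x \<in> qV q" for N x
  proof -
    obtain n where x: "x = q ^ n \<or> x = - (q ^ n)" using \<open>x \<in> qV q\<close> by (auto simp: qV_def)
    define EN where "EN = e n - (qfourier_a0 q f / 2 + (\<Sum>k<N. qfourier_a q f (Suc k) * cos_mode k n))"
    define DN where "DN = d n - (\<Sum>k<N. qfourier_b q f (Suc k) * sin_mode k (Suc n))"
    have f_eq: "f (q ^ n) = e n + d n" "f (- (q ^ n)) = e n - d n"
      by (simp_all add: e_def d_def field_simps)
    have "f (q ^ n) - qfourier_partial_sum q f N (q ^ n) = EN + DN"
      unfolding f_eq qfourier_partial_sum_def One_nat_def sum.atLeast1_atMost_eq qcos_grid qsin_grid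
      by (simp add: EN_def DN_def sum.distrib)
    moreover have "f (- (q ^ n)) - qfourier_partial_sum q f N (- (q ^ n)) = EN - DN"
      unfolding f_eq qfourier_partial_sum_def One_nat_def sum.atLeast1_atMost_eq qcos_grid qsin_grid
      by (simp add: EN_def DN_def sum_subtractf)
    moreover have "norm EN \<le> \<epsilon>2 N" "norm DN \<le> \<epsilon>1 N"
      unfolding EN_def DN_def by (rule \<epsilon>1 \<epsilon>2)+
    ultimately have "norm (f x - qfourier_partial_sum q f N x) \<le> \<epsilon>1 N + \<epsilon>2 N"
      using x norm_triangle_ineq[of EN DN] norm_triangle_ineq4[of EN DN] by auto
    then show ?thesis by (simp add: dist_norm norm_minus_commute)
  qed
  have "(\<lambda>N. \<epsilon>1 N + \<epsilon>2 N) \<longlonglongrightarrow> 0 + 0" by (intro tendsto_intros \<epsilon>1 \<epsilon>2)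
  then have lim0: "(\<lambda>N. \<epsilon>1 N + \<epsilon>2 N) \<longlonglongrightarrow> 0" by simp
  show ?thesis
    unfolding uniform_limit_iff
  proof (intro allI impI)
    fix \<epsilon> :: real assume "\<epsilon> > 0"
    then have "eventually (\<lambda>N. \<epsilon>1 N + \<epsilon>2 N < \<epsilon>) sequentially" by (rule order_tendstoD(2)[OF lim0])
    then show "eventually (\<lambda>N. \<forall>x\<in>qV q. dist (qfourier_partial_sum q f N x) (f x) < \<epsilon>) sequentially"
      by (rule eventually_mono) (blast intro: order_le_less_trans[OF bound])
  qed
qed

end

theorem theorem4p1:
  fixes q lam :: real and D :: "real set" and f :: "real \<Rightarrow> complex"
  assumes "0 < q" and "q \<le> (1/50) powr (1/49)"
    and "\<And>n::int. n \<ge> -1 \<Longrightarrow> q powi n \<in> D \<and> - (q powi n) \<in> D"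
    and "f \<in> qLinf q"
    and "lam > 1/2" and "qlinear_Hoelder q lam f"
    and "one_sided_limits_agree_at_0 D f"
  shows "uniform_limit (qV q) (qfourier_partial_sum q f) f sequentially"
proof -
  have "(1/50 :: real) powr (1/49) < 1 powr (1/49)" by (intro powr_less_mono2) auto
  then have q1: "q < 1" using assms(2) by simp
  interpret qtrig q using assms(1) q1 by unfold_locales
  have in_D: "q ^ n \<in> D" "- (q ^ n) \<in> D" for n
    using assms(3)[of "int n"] by (simp_all add: power_int_of_nat)
  obtain l where l: "(f \<longlongrightarrow> l) (at 0 within (D \<inter> {0<..}))" "(f \<longlongrightarrow> l) (at 0 within (D \<inter> {..<0}))"
    using assms(7) unfolding one_sided_limits_agree_at_0_def by blast
  have "filterlim (\<lambda>n. q ^ n) (at 0 within (D \<inter> {0<..})) sequentially"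
    unfolding filterlim_at using q_power_tendsto_0 in_D q_pos by auto
  then have lim1: "(\<lambda>n. f (q ^ n)) \<longlonglongrightarrow> l" by (rule filterlim_compose[OF l(1)])
  have "filterlim (\<lambda>n. - (q ^ n)) (at 0 within (D \<inter> {..<0})) sequentially"
    unfolding filterlim_at using tendsto_minus[OF q_power_tendsto_0] in_D q_pos by auto
  then have lim2: "(\<lambda>n. f (- (q ^ n))) \<longlonglongrightarrow> l" by (rule filterlim_compose[OF l(2)])
  obtain M where M: "\<And>n::nat. norm (f (q powi (int n - 1)) - f (q powi int n)) \<le> M * q powr (lam * real n)"
    "\<And>n::nat. norm (f (- (q powi (int n - 1))) - f (- (q powi int n))) \<le> M * q powr (lam * real n)"
    using assms(6) unfolding qlinear_Hoelder_def by blast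
  define Q where "Q = q powr lam"
  have Q_power: "q powr (lam * real n) = Q ^ n" for n
    using q_pos by (simp add: Q_def powr_power mult.commute)
  have "q powr (2 * lam) < q powr 1" using assms(5) q_pos q_less_1 by (intro powr_less_mono') auto
  then have Q: "Q\<^sup>2 < q" using q_pos by (simp add: Q_def powr_power mult.commute)
  have decay: "norm (f (q ^ n) - f (q ^ Suc n)) \<le> M * Q * Q ^ n"
    "norm (f (- (q ^ n)) - f (- (q ^ Suc n))) \<le> M * Q * Q ^ n" for n
  proof -
    have "int (Suc n) - 1 = int n" by simp
    then show "norm (f (q ^ n) - f (q ^ Suc n)) \<le> M * Q * Q ^ n"
      "norm (f (- (q ^ n)) - f (- (q ^ Suc n))) \<le> M * Q * Q ^ n"
      using M[of "Suc n"] unfolding Q_power power_Suc[of Q]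
      by (simp_all only: power_int_of_nat mult.assoc)
  qed
  show ?thesis
    by (rule qfourier_converges_uniformly[where M = "M * Q" and Q = Q, OF lim1 lim2 decay Q])
qed

end
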